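(* Let $n\ge3$ and let $\mathcal{N}$ be the Newtonian potential in $\mathbb{R}^n$. There exist constants $C(n)>0$ and $\epsilon_0(n)\in(0,1)$, depending only on $n$, such that for every $\epsilon\in(0,\epsilon_0(n))$ there exists $\rho\in L^1_+(\mathbb{R}^n)\cap L^\infty(\mathbb{R}^n)$ supported in $B(0,7)$ with $\omega_n\le\|\rho\|_1\le2\omega_n$ and $\|\rho\|_\infty=\epsilon^{-(\frac n2+1)}$, such that $$0<\mathcal{E}_{\mathcal{N}}[\rho^*]-\mathcal{E}_{\mathcal{N}}[\rho]<C(n)\,\epsilon^{\frac n2-1}\inf_{a\in\mathbb{R}^n}\mathcal{E}_{\mathcal{N}}[T_a\rho-\rho^*].$$
   Context: $L^1_+(\mathbb{R}^n)$ is the set of nonnegative functions in $L^1(\mathbb{R}^n)$; $\|\cdot\|_p$ is the $L^p(\mathbb{R}^n)$ norm; $B(a,r)$ is the ball in $\mathbb{R}^n$ centered at $a$ with radius $r$; $\omega_n$ is the volume of the unit ball in $\mathbb{R}^n$. For $n\ge3$ the Newtonian potential (fundamental solution of $-\Delta$) is $\mathcal{N}(x)=\frac{1}{n(n-2)\omega_n}|x|^{2-n}$. For a (possibly sign-changing) function $f$, $$\mathcal{E}_{\mathcal{N}}[f]:=\int_{\mathbb{R}^n}\int_{\mathbb{R}^n}f(x)f(y)\mathcal{N}(x-y)\,dx\,dy .$$ $\rho^*$ denotes the radially symmetric decreasing rearrangement of $\rho$: $\rho^*(x)=\int_0^\infty 1_{D_h^*}(x)\,dh$ with $D_h=\{\rho>h\}$,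 where for a set $D$ of finite measure $D^*$ is the ball centered at the origin with $|D^*|=|D|$. For $a\in\mathbb{R}^n$, $T_a\rho:=\rho(\cdot+a)$. *)

theory Defs
  imports "HOL-Analysis.Analysis" "HOL-Probability.Essential_Supremum"
begin

definition unit_ball_volume :: "'a::euclidean_space itself \<Rightarrow> real"
  where "unit_ball_volume _ = measure lebesgue (ball (0::'a) 1)"

text \<open>Functions are taken as representatives of their classes modulo null sets.\<close>

definition L1_nonneg :: "('a::euclidean_space \<Rightarrow> real) set"
  where "L1_nonneg = {f. integrable lebesgue f \<and> (\<forall>x. 0 \<le> f x)}"

definition L1_norm :: "('a::euclidean_space \<Rightarrow> real) \<Rightarrow> real"
  where "L1_norm f = (LINT x|lebesgue. \<bar>f x\<bar>)"

definition Linfty_norm :: "('a::euclidean_space \<Rightarrow> real) \<Rightarrow> ereal"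
  where "Linfty_norm f = esssup lebesgue (\<lambda>x. ereal \<bar>f x\<bar>)"

definition Linfty :: "('a::euclidean_space \<Rightarrow> real) set"
  where "Linfty = {f. f \<in> borel_measurable lebesgue \<and> Linfty_norm f < \<infinity>}"

text \<open>Meant for dimension at least 3. At the origin, where the Newtonian potential is infinite,
  this function takes the value 0 (because \<^term>\<open>0 powr a = 0\<close>). This changes no integral.\<close>

definition newtonian_potential :: "'a::euclidean_space \<Rightarrow> real"
  where "newtonian_potential x =
    1 / (real DIM('a) * (real DIM('a) - 2) * unit_ball_volume TYPE('a))
      * norm x powr (2 - real DIM('a))"

text \<open>The integral is a Bochner integral, which is 0 for non-integrable integrands; when
  \<^term>\<open>f\<close> is bounded with bounded support the double integral is absolutely convergent.\<close>

definition newtonian_energy :: "('a::euclidean_space \<Rightarrow> real) \<Rightarrow> real"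
  where "newtonian_energy f =
    (LINT y|lebesgue. (LINT x|lebesgue. f x * f y * newtonian_potential (x - y)))"

definition symmetrized_set :: "'a::euclidean_space set \<Rightarrow> 'a set"
  where "symmetrized_set D =
    ball 0 (THE r. 0 \<le> r \<and> measure lebesgue (ball (0::'a) r) = measure lebesgue D)"

definition decreasing_rearrangement :: "('a::euclidean_space \<Rightarrow> real) \<Rightarrow> 'a \<Rightarrow> real"
  where "decreasing_rearrangement \<rho> x =
    (LINT h:{0<..}|lebesgue. indicator (symmetrized_set {y. \<rho> y > h}) x)"

definition translate_fun :: "'a::euclidean_space \<Rightarrow> ('a \<Rightarrow> real) \<Rightarrow> 'a \<Rightarrow> real"
  where "translate_fun a \<rho> = (\<lambda>x. \<rho> (x + a))"

end

theory Submission
  imports Defs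
begin

text \<open>Up to a constant, the Newtonian potential \<open>N(x - y)\<close> is the integral of
  \<open>1\<^bsub>B(z,r)\<^esub>(x) 1\<^bsub>B(z,r)\<^esub>(y) r\<^bsup>1-2n\<^esup>\<close> over all balls \<open>B(z,r)\<close>, since this integral is
  invariant under isometries and homogeneous of degree \<open>2 - n\<close>. Hence the energy of \<open>f\<close> is a weighted
  integral of the squares of the masses that \<open>f\<close> gives to balls, and it is bounded below as soon as
  \<open>f \<le> - k\<close> on some ball.

  Take \<open>\<rho>\<close> to be the indicator of the annulus \<open>B(0,1) - B(0,\<epsilon>)\<close> plus \<open>K = \<epsilon>\<^bsup>-(n/2+1)\<^esup>\<close> times the
  indicator of \<open>B(p,\<epsilon>)\<close>, where \<open>p\<close> has norm 5; its rearrangement is the same function with \<open>p = 0\<close>.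
  The small ball has mass of order \<open>\<epsilon>\<^bsup>n/2-1\<^esup>\<close>, which bounds the energy deficit, but its self-energy
  has order 1. A translate of \<open>\<rho>\<close> cannot match both the small ball and the annulus of \<open>\<rho>\<^sup>*\<close>, and
  either mismatch costs an energy of order 1.\<close>

section \<open>The Newtonian potential as an average over balls\<close>

text \<open>A pair \<open>q = (z, r)\<close> stands for the open ball with center \<open>z\<close> and radius \<open>r\<close>; for \<open>r \<le> 0\<close> the
  kernel vanishes, so integrals over all \<open>q\<close> only see \<open>r > 0\<close>.\<close>

definition in_ball :: "'a::euclidean_space \<Rightarrow> 'a \<times> real \<Rightarrow> real"
  where "in_ball x q = of_bool (dist x (fst q) < snd q)"

definition ball_kernel :: "'a::euclidean_space \<Rightarrow> 'a \<Rightarrow> 'a \<times> real \<Rightarrow> real"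
  where "ball_kernel x y q = in_ball x q * in_ball y q / snd q ^ (2 * DIM('a) - 1)"

text \<open>The value is extended: invariance and scaling are proved before finiteness is known, and
  on the diagonal no finite value is claimed.\<close>

definition ball_potential :: "'a::euclidean_space \<Rightarrow> 'a \<Rightarrow> ennreal"
  where "ball_potential x y = (\<integral>\<^sup>+q. ball_kernel x y q \<partial>lborel)"

lemma in_ball_range: "0 \<le> in_ball x q" "in_ball x q \<le> 1"
  by (auto simp: in_ball_def)

text \<open>The incidence relation is open in the pair of point and ball, so measurability holds
  jointly in both arguments, as Fubini requires.\<close>

lemma borel_measurable_in_ball [measurable]:
  fixes f :: "'b \<Rightarrow> 'a::euclidean_space"
  assumes [measurable]: "f \<in> M \<rightarrow>\<^sub>M borel" "g \<in> M \<rightarrow>\<^sub>M borel"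
  shows "(\<lambda>p. in_ball (f p) (g p)) \<in> borel_measurable M"
proof -
  have "open {p::'a \<times> ('a \<times> real). dist (fst p) (fst (snd p)) < snd (snd p)}"
    by (intro open_Collect_less continuous_intros)
  then have "indicat_real {p::'a \<times> ('a \<times> real). dist (fst p) (fst (snd p)) < snd (snd p)}
      \<in> borel_measurable (borel \<Otimes>\<^sub>M borel)"
    by (simp add: borel_prod)
  then have "(\<lambda>p. indicat_real {p::'a \<times> ('a \<times> real). dist (fst p) (fst (snd p)) < snd (snd p)}
      (f p, g p)) \<in> borel_measurable M"
    by (rule measurable_compose[rotated]) measurable
  then show ?thesis
    by (simp add: in_ball_def indicator_def)
qed

lemma borel_measurable_ball_kernel [measurable]:
  fixes f :: "'b \<Rightarrow> 'a::euclidean_space"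
  assumes [measurable]: "f \<in> M \<rightarrow>\<^sub>M borel" "g \<in> M \<rightarrow>\<^sub>M borel" "h \<in> M \<rightarrow>\<^sub>M borel"
  shows "(\<lambda>p. ball_kernel (f p) (g p) (h p)) \<in> borel_measurable M"
proof -
  have [measurable]: "(\<lambda>p. snd (h p)) \<in> borel_measurable M"
    using assms(3) by (rule measurable_compose) (intro borel_measurable_continuous_onI continuous_intros)
  show ?thesis
    unfolding ball_kernel_def by measurable
qed

text \<open>The exponent of the radius is odd, so the denominator is negative for negative radii;
  there the factor \<open>in_ball\<close> vanishes.\<close>

lemma ball_kernel_nonneg: "0 \<le> ball_kernel x y q"
proof (cases "snd q \<le> 0")
  case True
  then have "in_ball x q = 0"
    by (simp add: in_ball_def) (smt (verit) zero_le_dist)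
  then show ?thesis by (simp add: ball_kernel_def)
qed (auto simp: ball_kernel_def in_ball_range)

lemma borel_measurable_ball_potential [measurable]:
  fixes f :: "'b \<Rightarrow> 'a::euclidean_space"
  assumes [measurable]: "f \<in> M \<rightarrow>\<^sub>M borel" "g \<in> M \<rightarrow>\<^sub>M borel"
  shows "(\<lambda>p. ball_potential (f p) (g p)) \<in> borel_measurable M"
  unfolding ball_potential_def by measurable

section \<open>Translations and dilations of the ball potential\<close>

lemma ball_potential_translate:
  "ball_potential (x + v) (y + v) = ball_potential x y" for v :: "'a::euclidean_space"
proof -
  have "ball_potential (x + v) (y + v) =
      (\<integral>\<^sup>+q. ball_kernel (x + v) (y + v) q \<partial>distr lborel borel ((+) (v, 0)))"
    by (simp add: ball_potential_def lborel_distr_plus)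
  also have "\<dots> = (\<integral>\<^sup>+q. ball_kernel (x + v) (y + v) ((v, 0) + q) \<partial>lborel)"
    by (subst nn_integral_distr) auto
  also have "\<dots> = ball_potential x y"
    unfolding ball_potential_def
    by (intro nn_integral_cong) (auto simp: ball_kernel_def in_ball_def dist_norm)
  finally show ?thesis .
qed

text \<open>Dilate the balls together with the points. With n the dimension, the space of balls has
  dimension n + 1, so the Jacobian is t^(n+1), while the kernel contributes t^(-(2n-1)). The
  exponents add up to 2 - n, which is what the power of the radius in \<open>ball_kernel\<close> is
  chosen for.\<close>

lemma ball_potential_scale:
  fixes x y :: "'a::euclidean_space"
  assumes "t > 0"
  shows "ball_potential (t *\<^sub>R x) (t *\<^sub>R y) = ennreal (t powr (2 - real DIM('a))) * ball_potential x y"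
proof -
  \<comment> \<open>The summand 0 keeps the form of the affine substitution
    \<open>lborel_affine\<close>.\<close>
  have *: "ball_kernel (t *\<^sub>R x) (t *\<^sub>R y) (0 + t *\<^sub>R q) = ball_kernel x y q / t ^ (2 * DIM('a) - 1)" for q
    using assms by (simp add: ball_kernel_def in_ball_def dist_norm power_mult_distrib
        flip: scaleR_diff_right)
  have "ball_potential (t *\<^sub>R x) (t *\<^sub>R y) = (\<integral>\<^sup>+q. ball_kernel (t *\<^sub>R x) (t *\<^sub>R y) q
     \<partial>density (distr lborel borel (\<lambda>q. 0 + t *\<^sub>R q)) (\<lambda>_. \<bar>t\<bar> ^ DIM('a \<times> real)))"
    unfolding ball_potential_def using assms by (subst lborel_affine[of t 0]) auto
  also have "\<dots> = (\<integral>\<^sup>+q. ennreal (t ^ (DIM('a) + 1)) *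
      ball_kernel (t *\<^sub>R x) (t *\<^sub>R y) (0 + t *\<^sub>R q) \<partial>lborel)"
    using assms by (subst nn_integral_density, simp, simp, subst nn_integral_distr) (auto simp del: power_Suc)
  also have "\<dots> = (\<integral>\<^sup>+q. ennreal (t powr (2 - real DIM('a))) * ball_kernel x y q \<partial>lborel)"
  proof (rule nn_integral_cong)
    fix q
    have "t powr (2 - real DIM('a)) = t powr (real (DIM('a) + 1) - real (2 * DIM('a) - 1))"
      using DIM_positive[where 'a='a] by (intro arg_cong[of _ _ "\<lambda>s. t powr s"]) (simp add: of_nat_diff)
    also have "\<dots> = t ^ (DIM('a) + 1) / t ^ (2 * DIM('a) - 1)"
      using assms by (simp only: powr_diff powr_realpow)
    finally have e: "t powr (2 - real DIM('a)) = t ^ (DIM('a) + 1) / t ^ (2 * DIM('a) - 1)" .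
    show "ennreal (t ^ (DIM('a) + 1)) * ball_kernel (t *\<^sub>R x) (t *\<^sub>R y) (0 + t *\<^sub>R q)
        = ennreal (t powr (2 - real DIM('a))) * ball_kernel x y q"
      unfolding * e using assms
      by (simp add: ball_kernel_nonneg flip: ennreal_mult)
  qed
  also have "\<dots> = ennreal (t powr (2 - real DIM('a))) * ball_potential x y"
    unfolding ball_potential_def by (rule nn_integral_cmult) measurable
  finally show ?thesis .
qed

section \<open>Invariance of Lebesgue measure under linear isometries\<close>

lemma nn_integral_lborel_translate:
  fixes c :: "'a::euclidean_space"
  assumes [measurable]: "f \<in> borel_measurable borel"
  shows "(\<integral>\<^sup>+x. f (x + c) \<partial>lborel) = (\<integral>\<^sup>+x. f x \<partial>lborel)"
proof -
  have "(\<integral>\<^sup>+x. f x \<partial>lborel) = (\<integral>\<^sup>+x. f x \<partial>distr lborel borel ((+) c))"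
    by (simp add: lborel_distr_plus)
  also have "\<dots> = (\<integral>\<^sup>+x. f (x + c) \<partial>lborel)"
    by (subst nn_integral_distr) (auto simp: add.commute)
  finally show ?thesis by simp
qed

text \<open>The argument is the uniqueness proof for Haar measure: both sides are translation invariant,
  and they agree on the unit ball.\<close>

lemma lborel_distr_isometry:
  fixes T :: "'a::euclidean_space \<Rightarrow> 'a"
  assumes "linear T" and norm: "\<And>x. norm (T x) = norm x"
  shows "distr lborel borel T = lborel"
proof (rule measure_eqI)
  interpret T: linear T by fact
  have [measurable]: "T \<in> borel \<rightarrow>\<^sub>M borel"
    using assms by (intro borel_measurable_continuous_onI linear_continuous_on linear_conv_bounded_linear[THEN iffD1])
  have "inj T"
    by (rule injI) (metis T.diff eq_iff_diff_eq_0 norm norm_eq_zero)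
  then have surj: "surj T"
    using assms(1) linear_injective_imp_surjective by blast
  fix A assume "A \<in> sets (distr lborel borel T)"
  then have [measurable]: "A \<in> sets borel" by simp
  let ?B = "ball (0::'a) 1"
  have [measurable]: "?B \<in> sets borel" by simp
  \<comment> \<open>The double integral of 1_A(T x + y) 1_B(y) is evaluated in both orders. With x
    inside, a shift of x by a preimage of y removes y from the first factor; with y inside, a shift
    of y by T x moves T x to the second factor.\<close>
  have "emeasure lborel (T -` A) * emeasure lborel ?B
      = (\<integral>\<^sup>+y. (\<integral>\<^sup>+x. indicator A (T x) \<partial>lborel) * indicator ?B y \<partial>lborel)"
  proof -
    have "(\<integral>\<^sup>+x. indicator A (T x) \<partial>lborel) = (\<integral>\<^sup>+x. indicator (T -` A) x \<partial>lborel :: ennreal)"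
      by (simp add: indicator_vimage)
    also have "\<dots> = emeasure lborel (T -` A)"
      by (rule nn_integral_indicator) (use measurable_sets_borel[of T borel A] in simp)
    finally show ?thesis
      by (subst nn_integral_cmult_indicator) auto
  qed
  also have "\<dots> = (\<integral>\<^sup>+y. (\<integral>\<^sup>+x. indicator A (T x + y) * indicator ?B y \<partial>lborel) \<partial>lborel)"
  proof (rule nn_integral_cong)
    fix y
    obtain c where c: "y = T c" using surj by blast
    have "(\<integral>\<^sup>+x. indicator A (T x) \<partial>lborel) = (\<integral>\<^sup>+x. indicator A (T (x + c)) \<partial>lborel :: ennreal)"
      by (rule nn_integral_lborel_translate[symmetric]) measurable
    then show "(\<integral>\<^sup>+x. indicator A (T x) \<partial>lborel) * indicator ?B y
        = (\<integral>\<^sup>+x. indicator A (T x + y) * indicator ?B y \<partial>lborel :: ennreal)"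
      by (simp add: c T.add nn_integral_multc)
  qed
  also have "\<dots> = (\<integral>\<^sup>+x. (\<integral>\<^sup>+y. indicator A (y + T x) * indicator ?B y \<partial>lborel) \<partial>lborel)"
  proof -
    have "(\<lambda>p. indicator A (T (fst p) + snd p) * indicator ?B (snd p) :: ennreal)
        \<in> borel_measurable (lborel \<Otimes>\<^sub>M lborel)"
      by measurable
    from lborel_pair.Fubini[OF this] show ?thesis
      by (simp add: add.commute)
  qed
  also have "\<dots> = (\<integral>\<^sup>+x. (\<integral>\<^sup>+y. indicator A y * indicator ?B (y - T x) \<partial>lborel) \<partial>lborel)"
  proof (rule nn_integral_cong)
    fix x
    show "(\<integral>\<^sup>+y. indicator A (y + T x) * indicator ?B y \<partial>lborel)
        = (\<integral>\<^sup>+y. indicator A y * indicator ?B (y - T x) \<partial>lborel)"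
      by (subst nn_integral_lborel_translate[symmetric, where c = "T x"]) auto
  qed
  also have "\<dots> = (\<integral>\<^sup>+y. (\<integral>\<^sup>+x. indicator A y * indicator ?B (y - T x) \<partial>lborel) \<partial>lborel)"
  proof -
    have "(\<lambda>p. indicator A (snd p) * indicator ?B (snd p - T (fst p)) :: ennreal)
        \<in> borel_measurable (lborel \<Otimes>\<^sub>M lborel)"
      by measurable
    from lborel_pair.Fubini[OF this] show ?thesis
      by simp
  qed
  also have "\<dots> = (\<integral>\<^sup>+y. emeasure lborel ?B * indicator A y \<partial>lborel)"
  proof (rule nn_integral_cong)
    fix y
    obtain c where c: "y = T c" using surj by blast
    \<comment> \<open>The isometry enters here: T x is within distance 1 of y = T c exactly if x is
      within distance 1 of c.\<close>
    have "indicator ?B (y - T x) = (indicator (ball c 1) x :: ennreal)" for x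
      by (simp add: c indicator_def norm dist_norm flip: T.diff)
    then have "(\<integral>\<^sup>+x. indicator A y * indicator ?B (y - T x) \<partial>lborel)
        = indicator A y * emeasure lborel (ball c 1)"
      by (simp add: nn_integral_cmult_indicator)
    then show "(\<integral>\<^sup>+x. indicator A y * indicator ?B (y - T x) \<partial>lborel)
        = emeasure lborel ?B * indicator A y"
      by (simp add: emeasure_ball mult.commute)
  qed
  also have "\<dots> = emeasure lborel A * emeasure lborel ?B"
    by (subst nn_integral_cmult_indicator) (auto simp: mult.commute)
  \<comment> \<open>The common factor can be cancelled because the unit ball has positive finite
    volume.\<close>
  finally have "emeasure lborel (T -` A) = emeasure lborel A"
    by (simp add: ennreal_mult_cancel_left emeasure_ball mult.commute[of _ "ennreal (unit_ball_vol _)"]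
        ennreal_eq_0_iff not_less[symmetric])
  then show "emeasure (distr lborel borel T) A = emeasure lborel A"
    by (simp add: emeasure_distr)
qed simp

text \<open>The reflection in the hyperplane orthogonal to u - v exchanges two vectors u and v of
  equal norm.\<close>

lemma exists_linear_isometry:
  fixes u v :: "'a::euclidean_space"
  assumes "norm u = norm v"
  obtains T where "linear T" "\<And>x. norm (T x) = norm x" "T u = v"
proof (cases "u = v")
  case True
  then show ?thesis using that[of id] by (simp add: linear_id)
next
  case False
  define w where "w = u - v"
  define T where "T x = x - (2 * (x \<bullet> w) / (w \<bullet> w)) *\<^sub>R w" for x
  have w: "w \<bullet> w \<noteq> 0" using False by (simp add: w_def)
  have "linear T"
    by (intro linearI) (simp_all add: T_def inner_add_left algebra_simps add_divide_distrib)
  moreover have "norm (T x) = norm x" for x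
    using w by (simp add: norm_eq T_def inner_diff_left inner_diff_right inner_commute field_simps)
  \<comment> \<open>Equality of the norms makes the coefficient of w in \<open>T u\<close> equal to
    1, so that \<open>T u = u - w\<close>.\<close>
  moreover have "2 * (u \<bullet> w) = w \<bullet> w"
    using assms by (simp add: norm_eq w_def inner_diff_left inner_diff_right inner_commute)
  then have "T u = v"
    using w by (simp add: T_def) (simp add: w_def)
  ultimately show ?thesis using that by blast
qed

text \<open>The isometry acts on the centers and fixes the radii. The integral over balls is
  therefore split with the centers innermost, and invariance is applied at each fixed
  radius.\<close>

lemma ball_potential_isometry:
  fixes T :: "'a::euclidean_space \<Rightarrow> 'a"
  assumes "linear T" and norm: "\<And>x. norm (T x) = norm x"
  shows "ball_potential (T x) (T y) = ball_potential x y"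
proof -
  interpret T: linear T by fact
  have [measurable]: "T \<in> borel \<rightarrow>\<^sub>M borel"
    using assms by (intro borel_measurable_continuous_onI linear_continuous_on linear_conv_bounded_linear[THEN iffD1])
  have iso: "dist (T u) (T v) = dist u v" for u v
    by (simp add: dist_norm norm flip: T.diff)
  have split: "ball_potential u v = (\<integral>\<^sup>+r. \<integral>\<^sup>+z. ball_kernel u v (z, r) \<partial>lborel \<partial>lborel)" for u v :: 'a
    unfolding ball_potential_def
    by (subst lborel_prod[symmetric], subst lborel_pair.nn_integral_snd[symmetric])
       (simp_all add: case_prod_unfold lborel_prod)
  have "ball_potential (T x) (T y)
      = (\<integral>\<^sup>+r. \<integral>\<^sup>+z. ball_kernel (T x) (T y) (z, r) \<partial>distr lborel borel T \<partial>lborel)"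
    by (simp add: split lborel_distr_isometry[OF assms])
  also have "\<dots> = (\<integral>\<^sup>+r. \<integral>\<^sup>+z. ball_kernel (T x) (T y) (T z, r) \<partial>lborel \<partial>lborel)"
    by (intro nn_integral_cong nn_integral_distr) auto
  also have "\<dots> = ball_potential x y"
    by (simp add: split ball_kernel_def in_ball_def iso)
  finally show ?thesis .
qed

text \<open>A translation moves y to the origin, an isometry turns e into the direction of x - y,
  and a dilation adjusts the length. Only one unknown number remains, the value at a unit
  vector.\<close>

lemma ball_potential_radial:
  fixes x y e :: "'a::euclidean_space"
  assumes "x \<noteq> y" "norm e = 1"
  shows "ball_potential x y = ennreal (norm (x - y) powr (2 - real DIM('a))) * ball_potential e 0"
proof -
  obtain T where T: "linear T" "\<And>x. norm (T x) = norm x" "T e = (x - y) /\<^sub>R norm (x - y)"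
    using exists_linear_isometry[of e "(x - y) /\<^sub>R norm (x - y)"] assms by auto
  have T0: "T 0 = 0" using T(2)[of 0] by simp
  have "ball_potential x y = ball_potential ((x - y) + y) (0 + y)" by simp
  also have "\<dots> = ball_potential (x - y) 0" by (rule ball_potential_translate)
  \<comment> \<open>The origin is written as a multiple of \<open>T 0\<close>, so that scaling and
    isometry can act on both arguments.\<close>
  also have "\<dots> = ball_potential (norm (x - y) *\<^sub>R T e) (norm (x - y) *\<^sub>R T 0)"
    using assms T T0 by simp
  also have "\<dots> = ennreal (norm (x - y) powr (2 - real DIM('a))) * ball_potential e 0"
    using assms by (subst ball_potential_scale) (simp_all add: ball_potential_isometry T(1,2) del: scaleR_zero_right)
  finally show ?thesis .
qed

text \<open>The balls that contain both points form a nonempty open set of pairs, on which the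
  kernel is positive; such a set is not null.\<close>

lemma ball_potential_pos:
  fixes x y :: "'a::euclidean_space"
  shows "0 < ball_potential x y"
proof (rule ccontr)
  assume "\<not> 0 < ball_potential x y"
  then have "AE q in lborel. ennreal (ball_kernel x y q) = 0"
    unfolding ball_potential_def by (subst (asm) not_gr_zero, subst (asm) nn_integral_0_iff_AE) auto
  moreover have "ball_kernel x y q > 0" if "dist x (fst q) < snd q" "dist y (fst q) < snd q" for q
  proof -
    have "snd q > 0" using that zero_le_dist le_less_trans by blast
    then show ?thesis using that by (simp add: ball_kernel_def in_ball_def)
  qed
  ultimately have AE: "AE q in lborel. q \<notin> {q. dist x (fst q) < snd q \<and> dist y (fst q) < snd q}" (is "AE q in lborel. q \<notin> ?U")
    by (auto elim!: eventually_mono simp: ennreal_eq_0_iff not_le[symmetric] simp del: split_paired_All)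
  have "open ?U"
    by (intro open_Collect_conj open_Collect_less continuous_intros)
  moreover have "(x, dist y x + 1) \<in> ?U" by (simp add: add_pos_nonneg) (smt (verit) zero_le_dist)
  ultimately show False
    using AE open_not_negligible[of ?U]
    using null_sets_completionI[of ?U lborel] AE_iff_null_sets[of ?U lborel]
    by (metis (no_types, lifting) borel_open empty_iff negligible_iff_null_sets sets_lborel)
qed

lemma not_AE_notin_open:
  fixes U :: "'a::euclidean_space set"
  assumes "open U" "U \<noteq> {}"
  shows "\<not> (AE x in lborel. x \<notin> U)"
  using assms null_sets_completionI[of U lborel] AE_iff_null_sets[of U lborel] open_not_negligible[of U]
  by (auto simp: negligible_iff_null_sets)

lemma unit_ball_volume_eq: "unit_ball_volume TYPE('a::euclidean_space) = unit_ball_vol DIM('a)"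
  by (simp add: unit_ball_volume_def measure_completion content_ball)

text \<open>After exchanging the integrals, a ball of radius r containing 0 meets B(0,R) in volume
  at most V min(r,R)^n, and the centers of such balls fill a volume V r^n. What remains is the
  one-dimensional integral of V^2 min(r,R)^n r^(1-n), which converges at infinity because n is at
  least 3.\<close>

lemma ball_potential_finite_integral:
  fixes R :: real
  assumes dim: "3 \<le> DIM('a::euclidean_space)"
  shows "(\<integral>\<^sup>+x. indicator (ball 0 R) x * ball_potential x (0::'a) \<partial>lborel) < \<infinity>"
proof (cases "R > 0")
  case True
  define m where "m = DIM('a) - 3"
  have n: "DIM('a) = m + 3" using dim by (simp add: m_def)
  define V where "V = unit_ball_vol DIM('a)"
  have V: "V > 0" by (simp add: V_def)
  \<comment> \<open>\<open>g r\<close> bounds the inner integral for one ball of radius r that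
    contains 0. \<open>h\<close> majorizes min(r,R)^n r^(1-n): this is r for r \<le> R, and for
    larger r it is at most R^3 / r^2, as (R/r)^(n-3) \<le> 1.\<close>
  define g where "g r = V * min r R ^ DIM('a) / r ^ (2 * DIM('a) - 1)" for r
  define h where "h r = R * indicator {0..R} r + R ^ 3 / r\<^sup>2 * indicator {R..} r" for r
  have [measurable]: "g \<in> borel_measurable borel" "h \<in> borel_measurable borel"
    unfolding g_def h_def by measurable
  have gnn: "g r \<ge> 0" if "r > 0" for r using that V True by (simp add: g_def)
  have bound: "V * r ^ DIM('a) * g r \<le> V\<^sup>2 * h r" if "r > 0" for r
  proof -
    have "2 * (m + 3) - 1 = (m + 3) + (m + 2)" by simp
    then have "r ^ (2 * (m + 3) - 1) = r ^ (m + 3) * r ^ (m + 2)"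
      by (simp only: power_add)
    then have "r ^ (m + 3) / r ^ (2 * (m + 3) - 1) = 1 / r ^ (m + 2)"
      using that by simp
    moreover have "V * r ^ DIM('a) * g r
        = V\<^sup>2 * (min r R ^ (m + 3) * (r ^ (m + 3) / r ^ (2 * (m + 3) - 1)))"
      unfolding g_def n by (simp add: power2_eq_square)
    ultimately have e: "V * r ^ DIM('a) * g r = V\<^sup>2 * (min r R ^ (m + 3) / r ^ (m + 2))"
      by simp
    have "min r R ^ (m + 3) / r ^ (m + 2) \<le> h r"
    proof (cases "r \<le> R")
      case True
      then have "min r R ^ (m + 3) / r ^ (m + 2) = r"
        using that by (simp add: min_def power_add eval_nat_numeral)
      also have "\<dots> \<le> h r" using True that by (simp add: h_def indicator_def)
      finally show ?thesis .
    next
      case False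
      have "min r R ^ (m + 3) / r ^ (m + 2) = R ^ 3 / r\<^sup>2 * (R / r) ^ m"
        using False by (simp add: min_def power_add power_divide power2_eq_square field_simps)
      also have "\<dots> \<le> R ^ 3 / r\<^sup>2 * 1"
        using False \<open>R > 0\<close> by (intro mult_left_mono power_le_one) auto
      also have "\<dots> \<le> h r" using False by (simp add: h_def)
      finally show ?thesis .
    qed
    then show ?thesis unfolding e by (rule mult_left_mono) simp
  qed
  have meas: "(\<lambda>p. indicator (ball 0 R) (fst p) * ennreal (ball_kernel (fst p) (0::'a) (snd p)))
      \<in> borel_measurable (lborel \<Otimes>\<^sub>M lborel)"
  proof -
    have [measurable]: "ball (0::'a) R \<in> sets borel" by simp
    show ?thesis by measurable
  qed
  have "(\<integral>\<^sup>+x. indicator (ball 0 R) x * ball_potential x (0::'a) \<partial>lborel)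
      = (\<integral>\<^sup>+x. \<integral>\<^sup>+q. indicator (ball 0 R) x * ennreal (ball_kernel x (0::'a) q) \<partial>lborel \<partial>lborel)"
    unfolding ball_potential_def by (intro nn_integral_cong nn_integral_cmult[symmetric]) measurable
  also have "\<dots> = (\<integral>\<^sup>+q. \<integral>\<^sup>+x. indicator (ball 0 R) x * ennreal (ball_kernel x (0::'a) q) \<partial>lborel \<partial>lborel)"
    using lborel_pair.Fubini[OF meas] by simp
  also have "\<dots> \<le> (\<integral>\<^sup>+q. ennreal (in_ball (0::'a) q * g (snd q)) \<partial>lborel)"
  proof (rule nn_integral_mono)
    fix q :: "'a \<times> real"
    show "(\<integral>\<^sup>+x. indicator (ball 0 R) x * ennreal (ball_kernel x (0::'a) q) \<partial>lborel)
        \<le> ennreal (in_ball (0::'a) q * g (snd q))"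
    proof (cases "in_ball (0::'a) q = 0")
      case True
      then show ?thesis by (simp add: ball_kernel_def)
    next
      case False
      then have one: "in_ball (0::'a) q = 1" and d: "dist 0 (fst q) < snd q"
        by (auto simp: in_ball_def split: if_splits)
      then have r: "snd q > 0" using zero_le_dist le_less_trans by blast
      have "(\<integral>\<^sup>+x. indicator (ball 0 R) x * ennreal (ball_kernel x (0::'a) q) \<partial>lborel)
        = (\<integral>\<^sup>+x. ennreal (1 / snd q ^ (2 * DIM('a) - 1)) * indicator (ball 0 R \<inter> ball (fst q) (snd q)) x \<partial>lborel)"
        by (intro nn_integral_cong) (use d in \<open>simp add: ball_kernel_def in_ball_def indicator_def dist_commute\<close>)
      also have "\<dots> = ennreal (1 / snd q ^ (2 * DIM('a) - 1)) * emeasure lborel (ball 0 R \<inter> ball (fst q) (snd q))"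
        by (rule nn_integral_cmult_indicator) simp
      also have "emeasure lborel (ball 0 R \<inter> ball (fst q) (snd q)) \<le> ennreal (V * min (snd q) R ^ DIM('a))"
      proof (cases "snd q \<le> R")
        case True
        have "emeasure lborel (ball 0 R \<inter> ball (fst q) (snd q)) \<le> emeasure lborel (ball (fst q) (snd q))"
          by (intro emeasure_mono) auto
        then show ?thesis using True r by (simp add: emeasure_ball V_def min_def)
      next
        case False
        have "emeasure lborel (ball 0 R \<inter> ball (fst q) (snd q)) \<le> emeasure lborel (ball (0::'a) R)"
          by (intro emeasure_mono) auto
        then show ?thesis using False \<open>R > 0\<close> by (simp add: emeasure_ball V_def min_def)
      qed
      also have "ennreal (1 / snd q ^ (2 * DIM('a) - 1)) * ennreal (V * min (snd q) R ^ DIM('a))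
          = ennreal (in_ball (0::'a) q * g (snd q))"
        using r V \<open>R > 0\<close> by (simp add: one g_def flip: ennreal_mult)
      finally show ?thesis by (simp add: mult_left_mono)
    qed
  qed
  also have "\<dots> = (\<integral>\<^sup>+r. \<integral>\<^sup>+z. ennreal (in_ball (0::'a) (z, r) * g r) \<partial>lborel \<partial>lborel)"
  proof -
    have "(\<lambda>q. ennreal (in_ball (0::'a) q * g (snd q))) \<in> borel_measurable (lborel \<Otimes>\<^sub>M lborel)"
    proof -
      have [measurable]: "(\<lambda>q. in_ball (0::'a) q) \<in> borel_measurable (lborel \<Otimes>\<^sub>M lborel)"
        unfolding lborel_prod by measurable
      show ?thesis by measurable
    qed
    from lborel_pair.nn_integral_snd[OF this] show ?thesis by (simp add: lborel_prod)
  qed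
  also have "\<dots> \<le> (\<integral>\<^sup>+r. ennreal (V\<^sup>2) * ennreal (h r) \<partial>lborel)"
  proof (rule nn_integral_mono)
    fix r :: real
    show "(\<integral>\<^sup>+z. ennreal (in_ball (0::'a) (z, r) * g r) \<partial>lborel) \<le> ennreal (V\<^sup>2) * ennreal (h r)"
    proof (cases "r > 0")
      case True
      have "(\<integral>\<^sup>+z. ennreal (in_ball (0::'a) (z, r) * g r) \<partial>lborel)
          = (\<integral>\<^sup>+z. ennreal (g r) * indicator (ball (0::'a) r) z \<partial>lborel)"
        by (intro nn_integral_cong) (simp add: in_ball_def indicator_def)
      also have "\<dots> = ennreal (V * r ^ DIM('a) * g r)"
        using True V gnn[OF True] by (subst nn_integral_cmult_indicator)
          (auto simp: emeasure_ball V_def mult_ac simp flip: ennreal_mult)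
      also have "\<dots> \<le> ennreal (V\<^sup>2 * h r)" using bound[OF True] by (rule ennreal_leI)
      finally show ?thesis by (simp add: ennreal_mult')
    next
      case False
      have "in_ball (0::'a) (z, r) = 0" for z
        using False by (simp add: in_ball_def) (smt (verit) norm_ge_zero)
      then show ?thesis by simp
    qed
  qed
  also have "\<dots> = ennreal (V\<^sup>2) * (\<integral>\<^sup>+r. ennreal (h r) \<partial>lborel)"
    by (rule nn_integral_cmult) simp
  also have "\<dots> < \<infinity>"
  proof -
    have "(\<integral>\<^sup>+r. ennreal (h r) \<partial>lborel)
        = (\<integral>\<^sup>+r. ennreal R * indicator {0..R} r + ennreal (R ^ 3 / r\<^sup>2) * indicator {R..} r \<partial>lborel)"
      using \<open>R > 0\<close> by (intro nn_integral_cong) (simp add: h_def ennreal_plus indicator_def)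
    also have "\<dots> = ennreal R * ennreal R + (\<integral>\<^sup>+r. ennreal (R ^ 3 / r\<^sup>2) * indicator {R..} r \<partial>lborel)"
      using \<open>R > 0\<close> by (subst nn_integral_add) (auto simp: nn_integral_cmult_indicator)
    also have "(\<integral>\<^sup>+r. ennreal (R ^ 3 / r\<^sup>2) * indicator {R..} r \<partial>lborel) = ennreal (0 - (- (R ^ 3) / R))"
    proof (rule nn_integral_FTC_atLeast[where F = "\<lambda>r. - (R ^ 3) / r"])
      show "((\<lambda>r. - (R ^ 3) / r) has_real_derivative R ^ 3 / x\<^sup>2) (at x)" if "R \<le> x" for x
        using that \<open>R > 0\<close> by (auto intro!: derivative_eq_intros simp: power2_eq_square)
      show "((\<lambda>r. - (R ^ 3) / r) \<longlongrightarrow> 0) at_top"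
        by (intro tendsto_divide_0[OF tendsto_const] filterlim_at_top_imp_at_infinity filterlim_ident)
    qed (use \<open>R > 0\<close> in auto)
    finally show ?thesis by (simp add: ennreal_mult_less_top)
  qed
  finally show ?thesis .
qed (simp add: ball_empty)

text \<open>Both sides are multiples of the same power of the distance, so it suffices that the
  value of the ball potential at a unit vector is positive and finite. The diagonal is excluded:
  there the Newtonian potential is 0 by convention, while the ball potential is positive.\<close>

lemma newtonian_potential_eq_ball_potential:
  assumes dim: "3 \<le> DIM('a::euclidean_space)"
  obtains c where "c > 0"
    "\<And>x y :: 'a. x \<noteq> y \<Longrightarrow> ennreal (newtonian_potential (x - y)) = ennreal c * ball_potential x y"
proof -
  obtain e :: 'a where e: "norm e = 1"
    using vector_choose_size[of 1] by auto
  have fin: "ball_potential e 0 \<noteq> \<infinity>"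
  proof
    \<comment> \<open>By the radial formula an infinite value at one unit vector would make the
      potential infinite on the whole punctured unit ball, against the finiteness of its
      integral.\<close>
    assume inf: "ball_potential e 0 = \<infinity>"
    have "AE x in lborel. indicator (ball 0 1) x * ball_potential x (0::'a) \<noteq> \<infinity>"
    proof (rule nn_integral_PInf_AE)
      have [measurable]: "ball (0::'a) 1 \<in> sets borel" by simp
      show "(\<lambda>x. indicator (ball 0 1) x * ball_potential x (0::'a)) \<in> borel_measurable lborel"
        by measurable
    qed (use ball_potential_finite_integral[OF dim, of 1] in auto)
    moreover have "x \<notin> ball 0 1 - {0}" if "indicator (ball 0 1) x * ball_potential x (0::'a) \<noteq> \<infinity>" for x
      using that ball_potential_radial[of x 0 e] e inf
      by (auto simp: ennreal_mult_eq_top_iff)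
    ultimately have "AE x in lborel. x \<notin> ball (0::'a) 1 - {0}" by (auto elim: eventually_mono)
    moreover have "(1 / 2) *\<^sub>R e \<in> ball 0 1 - {0}" using e by auto
    ultimately show False
      using not_AE_notin_open[of "ball (0::'a) 1 - {0}"] open_delete by blast
  qed
  define G where "G = enn2real (ball_potential e 0)"
  have G: "ball_potential e 0 = ennreal G" "G > 0"
    using fin ball_potential_pos[of e 0] by (auto simp: G_def less_top enn2real_positive_iff)
  define c1 where "c1 = 1 / (real DIM('a) * (real DIM('a) - 2) * unit_ball_volume TYPE('a))"
  have c1: "c1 > 0" using dim by (simp add: c1_def unit_ball_volume_eq)
  show ?thesis
  proof (rule that[of "c1 / G"])
    fix x y :: 'a assume "x \<noteq> y"
    then show "ennreal (newtonian_potential (x - y)) = ennreal (c1 / G) * ball_potential x y"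
      using ball_potential_radial[of x y e] e c1 G
      by (simp add: newtonian_potential_def c1_def[symmetric] flip: ennreal_mult)
  qed (use c1 G in auto)
qed

section \<open>The interaction form\<close>

lemma newtonian_potential_nonneg:
  assumes "3 \<le> DIM('a::euclidean_space)"
  shows "0 \<le> newtonian_potential (x :: 'a)"
  using assms by (simp add: newtonian_potential_def unit_ball_volume_eq)

lemma newtonian_potential_minus: "newtonian_potential (- x) = newtonian_potential x"
  by (simp add: newtonian_potential_def)

lemma borel_measurable_newtonian_potential [measurable]:
  "newtonian_potential \<in> borel_measurable (borel :: 'a::euclidean_space measure)"
  unfolding newtonian_potential_def by measurable

lemma newtonian_potential_finite_integral:
  assumes dim: "3 \<le> DIM('a::euclidean_space)"
  shows "(\<integral>\<^sup>+x. indicator (ball 0 R) x * ennreal (newtonian_potential (x::'a)) \<partial>lborel) < \<infinity>"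
proof -
  obtain c where c: "\<And>x y :: 'a. x \<noteq> y \<Longrightarrow>
      ennreal (newtonian_potential (x - y)) = ennreal c * ball_potential x y"
    using newtonian_potential_eq_ball_potential[OF dim] by blast
  have [measurable]: "ball (0::'a) R \<in> sets borel" by simp
  have "(\<integral>\<^sup>+x. indicator (ball 0 R) x * ennreal (newtonian_potential (x::'a)) \<partial>lborel)
      = (\<integral>\<^sup>+x. ennreal c * (indicator (ball 0 R) x * ball_potential x (0::'a)) \<partial>lborel)"
  proof (rule nn_integral_cong_AE)
    show "AE x in lborel. indicator (ball 0 R) x * ennreal (newtonian_potential (x::'a))
        = ennreal c * (indicator (ball 0 R) x * ball_potential x (0::'a))"
      using AE_lborel_singleton[of "0::'a"] by eventually_elim (use c[of _ 0] in \<open>simp add: mult_ac\<close>)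
  qed
  also have "\<dots> = ennreal c * (\<integral>\<^sup>+x. indicator (ball 0 R) x * ball_potential x (0::'a) \<partial>lborel)"
    by (rule nn_integral_cmult) measurable
  also have "\<dots> < \<infinity>"
    using ball_potential_finite_integral[OF dim, of R] by (simp add: ennreal_mult_less_top)
  finally show ?thesis .
qed

text \<open>Moving the pole to the origin carries B(0,r) into B(0,r+s). The resulting bound is
  uniform in y and serves as the majorant for interactions.\<close>

lemma nn_integral_newtonian_potential_ball_le:
  fixes y :: "'a::euclidean_space"
  assumes "norm y \<le> s"
  shows "(\<integral>\<^sup>+x. indicator (ball 0 r) x * ennreal (newtonian_potential (x - y)) \<partial>lborel)
    \<le> (\<integral>\<^sup>+x. indicator (ball 0 (r + s)) x * ennreal (newtonian_potential (x::'a)) \<partial>lborel)"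
proof -
  have [measurable]: "ball (0::'a) r \<in> sets borel" by simp
  have "(\<integral>\<^sup>+x. indicator (ball 0 r) x * ennreal (newtonian_potential (x - y)) \<partial>lborel)
      = (\<integral>\<^sup>+x. indicator (ball 0 r) (x + y) * ennreal (newtonian_potential ((x + y) - y)) \<partial>lborel)"
    by (rule nn_integral_lborel_translate[symmetric]) measurable
  also have "\<dots> \<le> (\<integral>\<^sup>+x. indicator (ball 0 (r + s)) x * ennreal (newtonian_potential (x::'a)) \<partial>lborel)"
  proof (rule nn_integral_mono)
    fix x
    have "norm x < r + s" if "norm (x + y) < r"
      using that assms norm_triangle_ineq4[of "x + y" y] by simp
    then show "indicator (ball 0 r) (x + y) * ennreal (newtonian_potential ((x + y) - y))
        \<le> indicator (ball 0 (r + s)) x * ennreal (newtonian_potential x)"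
      by (auto simp: indicator_def)
  qed
  finally show ?thesis .
qed

section \<open>Bounded functions with bounded support\<close>

text \<open>A linear, translation invariant class on which the energy integrals converge absolutely.
  Borel measurability allows work with \<open>lborel\<close> and its products instead of the
  completed measure.\<close>

definition bounded_with_bounded_support :: "('a::euclidean_space \<Rightarrow> real) \<Rightarrow> bool"
  where "bounded_with_bounded_support f \<longleftrightarrow>
    f \<in> borel_measurable borel \<and> (\<exists>M R. \<forall>x. \<bar>f x\<bar> \<le> M * indicator (ball 0 R) x)"

lemma bounded_with_bounded_supportE:
  fixes f :: "'a::euclidean_space \<Rightarrow> real"
  assumes "bounded_with_bounded_support f"
  obtains M R where "M \<ge> 0" "R \<ge> 0" "\<And>x. \<bar>f x\<bar> \<le> M * indicator (ball 0 R) x"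
proof -
  obtain M R where b: "\<And>x. \<bar>f x\<bar> \<le> M * indicator (ball 0 R) x"
    using assms by (auto simp: bounded_with_bounded_support_def)
  have "\<bar>f x\<bar> \<le> \<bar>M\<bar> * indicator (ball 0 \<bar>R\<bar>) x" for x
    using b[of x] by (auto simp: indicator_def split: split_of_bool split_of_bool_asm)
  then show ?thesis using that[of "\<bar>M\<bar>" "\<bar>R\<bar>"] by simp
qed

lemma bounded_with_bounded_supportD [measurable_dest]:
  "bounded_with_bounded_support f \<Longrightarrow> f \<in> borel_measurable borel"
  by (simp add: bounded_with_bounded_support_def)

lemma bounded_with_bounded_support_add:
  assumes "bounded_with_bounded_support f" "bounded_with_bounded_support g"
  shows "bounded_with_bounded_support (\<lambda>x. f x + g x)"
proof -
  obtain M R where f: "M \<ge> 0" "R \<ge> 0" "\<And>x. \<bar>f x\<bar> \<le> M * indicator (ball 0 R) x"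
    using bounded_with_bounded_supportE[OF assms(1)] by blast
  obtain M' R' where g: "M' \<ge> 0" "R' \<ge> 0" "\<And>x. \<bar>g x\<bar> \<le> M' * indicator (ball 0 R') x"
    using bounded_with_bounded_supportE[OF assms(2)] by blast
  have "\<bar>f x + g x\<bar> \<le> (M + M') * indicator (ball 0 (max R R')) x" for x
    using f(3)[of x] g(3)[of x] f(1) g(1) by (auto simp: indicator_def split: split_of_bool split_of_bool_asm)
  then show ?thesis
    using assms unfolding bounded_with_bounded_support_def by auto
qed

lemma bounded_with_bounded_support_cmult:
  assumes "bounded_with_bounded_support f"
  shows "bounded_with_bounded_support (\<lambda>x. c * f x)"
proof -
  obtain M R where f: "M \<ge> 0" "R \<ge> 0" "\<And>x. \<bar>f x\<bar> \<le> M * indicator (ball 0 R) x"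
    using bounded_with_bounded_supportE[OF assms] by blast
  have "\<bar>c * f x\<bar> \<le> (\<bar>c\<bar> * M) * indicator (ball 0 R) x" for x
    using mult_left_mono[OF f(3)[of x], of "\<bar>c\<bar>"] by (simp add: abs_mult mult_ac)
  then show ?thesis
    using assms unfolding bounded_with_bounded_support_def by auto
qed

lemma bounded_with_bounded_support_diff:
  assumes "bounded_with_bounded_support f" "bounded_with_bounded_support g"
  shows "bounded_with_bounded_support (\<lambda>x. f x - g x)"
  using bounded_with_bounded_support_add[OF assms(1) bounded_with_bounded_support_cmult[OF assms(2), of "-1"]]
  by simp

lemma bounded_with_bounded_support_indicator:
  assumes "bounded A" "A \<in> sets borel"
  shows "bounded_with_bounded_support (indicat_real A)"
proof -
  obtain R where "A \<subseteq> ball 0 R"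
    using bounded_subset_ballD[OF assms(1)] by blast
  then have "\<bar>indicat_real A x\<bar> \<le> 1 * indicator (ball 0 R) x" for x
    by (auto simp: indicator_def)
  then show ?thesis
    using assms unfolding bounded_with_bounded_support_def by (intro conjI exI[of _ 1] exI[of _ R]) auto
qed

lemma bounded_with_bounded_support_translate:
  assumes "bounded_with_bounded_support f"
  shows "bounded_with_bounded_support (\<lambda>x. f (x + a))"
proof -
  have [measurable]: "f \<in> borel_measurable borel" using assms by measurable
  obtain M R where f: "M \<ge> 0" "R \<ge> 0" "\<And>x. \<bar>f x\<bar> \<le> M * indicator (ball 0 R) x"
    using bounded_with_bounded_supportE[OF assms] by blast
  have "\<bar>f (x + a)\<bar> \<le> M * indicator (ball 0 (R + norm a)) x" for x
  proof -
    have "norm x < R + norm a" if "norm (x + a) < R"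
      using that norm_triangle_ineq4[of "x + a" a] by simp
    then show ?thesis using f(3)[of "x + a"] f(1) by (auto simp: indicator_def split: split_of_bool split_of_bool_asm)
  qed
  then show ?thesis
    unfolding bounded_with_bounded_support_def by (intro conjI exI[of _ M] exI[of _ "R + norm a"]) auto
qed

lemma bounded_with_bounded_support_integrable:
  fixes f :: "'a::euclidean_space \<Rightarrow> real"
  assumes "bounded_with_bounded_support f"
  shows "integrable lborel f"
proof -
  obtain M R where f: "M \<ge> 0" "R \<ge> 0" "\<And>x. \<bar>f x\<bar> \<le> M * indicator (ball 0 R) x"
    using bounded_with_bounded_supportE[OF assms] by blast
  have "integrable lborel (\<lambda>x. M * indicat_real (ball (0::'a) R) x)"
    using emeasure_lborel_ball_finite[of "0::'a" R] by (intro integrable_mult_right integrable_real_indicator) auto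
  then show ?thesis
    by (rule Bochner_Integration.integrable_bound) (use f assms in auto)
qed

text \<open>The symmetric bilinear form behind the energy. It is a single integral over the product
  space, so that Fubini and changes of variables apply directly.\<close>

definition interaction :: "('a::euclidean_space \<Rightarrow> real) \<Rightarrow> ('a \<Rightarrow> real) \<Rightarrow> real"
  where "interaction f g =
    (\<integral>p. f (fst p) * g (snd p) * newtonian_potential (fst p - snd p) \<partial>lborel)"

lemma measurable_fst_snd_borel [measurable]:
  "fst \<in> (borel :: ('a::euclidean_space \<times> 'b::euclidean_space) measure) \<rightarrow>\<^sub>M borel"
  "snd \<in> (borel :: ('a::euclidean_space \<times> 'b::euclidean_space) measure) \<rightarrow>\<^sub>M borel"
  by (auto intro!: borel_measurable_continuous_onI continuous_intros)

text \<open>For y in a ball containing the support of g, the integral over x is bounded by the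
  integral of the potential over one fixed larger ball. Integrating this constant over the bounded
  set of y keeps it finite.\<close>

lemma interaction_integrable:
  fixes f g :: "'a::euclidean_space \<Rightarrow> real"
  assumes dim: "3 \<le> DIM('a)"
    and f: "bounded_with_bounded_support f" and g: "bounded_with_bounded_support g"
  shows "integrable lborel (\<lambda>p. f (fst p) * g (snd p) * newtonian_potential (fst p - snd p))"
proof (rule integrableI_bounded)
  have [measurable]: "f \<in> borel_measurable borel" "g \<in> borel_measurable borel" using f g by measurable
  obtain M R where fb: "M \<ge> 0" "R \<ge> 0" "\<And>x. \<bar>f x\<bar> \<le> M * indicator (ball 0 R) x"
    using bounded_with_bounded_supportE[OF f] by blast
  obtain M' R' where gb: "M' \<ge> 0" "R' \<ge> 0" "\<And>x. \<bar>g x\<bar> \<le> M' * indicator (ball 0 R') x"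
    using bounded_with_bounded_supportE[OF g] by blast
  have [measurable]: "ball (0::'a) R \<in> sets borel" "ball (0::'a) R' \<in> sets borel" by simp_all
  define L where "L = (\<integral>\<^sup>+x. indicator (ball 0 (R + R')) x * ennreal (newtonian_potential (x::'a)) \<partial>lborel)"
  have L: "L < \<infinity>" unfolding L_def by (rule newtonian_potential_finite_integral[OF dim])
  show meas: "(\<lambda>p. f (fst p) * g (snd p) * newtonian_potential (fst p - snd p)) \<in> borel_measurable lborel"
    by measurable
  have "(\<integral>\<^sup>+p. ennreal (norm (f (fst p) * g (snd p) * newtonian_potential (fst p - snd p))) \<partial>lborel)
      = (\<integral>\<^sup>+y. \<integral>\<^sup>+x. ennreal (norm (f x * g y * newtonian_potential (x - y))) \<partial>lborel \<partial>lborel)"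
  proof -
    have "(\<lambda>p. ennreal (norm (f (fst p) * g (snd p) * newtonian_potential (fst p - snd p))))
        \<in> borel_measurable (lborel \<Otimes>\<^sub>M lborel)" by measurable
    from lborel_pair.nn_integral_snd[OF this] show ?thesis by (simp add: lborel_prod)
  qed
  also have "\<dots> \<le> (\<integral>\<^sup>+y. ennreal (M * M') * L * indicator (ball (0::'a) R') y \<partial>lborel)"
  proof (rule nn_integral_mono)
    fix y :: 'a
    show "(\<integral>\<^sup>+x. ennreal (norm (f x * g y * newtonian_potential (x - y))) \<partial>lborel)
        \<le> ennreal (M * M') * L * indicator (ball 0 R') y"
    proof (cases "y \<in> ball 0 R'")
      case False
      then have "g y = 0" using gb(3)[of y] by simp
      then show ?thesis by simp
    next
      case True
      have "(\<integral>\<^sup>+x. ennreal (norm (f x * g y * newtonian_potential (x - y))) \<partial>lborel)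
          \<le> (\<integral>\<^sup>+x. ennreal (M * M') * (indicator (ball 0 R) x * ennreal (newtonian_potential (x - y))) \<partial>lborel)"
      proof (rule nn_integral_mono)
        fix x
        have "\<bar>f x * g y\<bar> \<le> M * indicator (ball 0 R) x * M'"
          unfolding abs_mult using fb(3)[of x] gb(3)[of y] True fb(1) by (intro mult_mono) auto
        then have "norm (f x * g y * newtonian_potential (x - y))
            \<le> M * indicator (ball 0 R) x * M' * newtonian_potential (x - y)"
          using newtonian_potential_nonneg[OF dim, of "x - y"]
          by (simp add: abs_mult mult_right_mono)
        then have "ennreal (norm (f x * g y * newtonian_potential (x - y)))
            \<le> ennreal (M * indicator (ball 0 R) x * M' * newtonian_potential (x - y))"
          by (rule ennreal_leI)
        also have "\<dots> = ennreal (M * M') * (indicator (ball 0 R) x * ennreal (newtonian_potential (x - y)))"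
          using newtonian_potential_nonneg[OF dim, of "x - y"] fb(1) gb(1)
          by (simp add: indicator_def ennreal_mult)
        finally show "ennreal (norm (f x * g y * newtonian_potential (x - y))) \<le> \<dots>" .
      qed
      also have "\<dots> = ennreal (M * M') * (\<integral>\<^sup>+x. indicator (ball 0 R) x * ennreal (newtonian_potential (x - y)) \<partial>lborel)"
        by (rule nn_integral_cmult) measurable
      also have "\<dots> \<le> ennreal (M * M') * L"
        unfolding L_def using True
        by (intro mult_left_mono nn_integral_newtonian_potential_ball_le) auto
      finally show ?thesis using True by simp
    qed
  qed
  also have "\<dots> < \<infinity>"
    using L emeasure_lborel_ball_finite[of "0::'a" R']
    by (subst nn_integral_cmult_indicator) (auto simp: ennreal_mult_less_top)
  finally show "(\<integral>\<^sup>+p. ennreal (norm (f (fst p) * g (snd p) * newtonian_potential (fst p - snd p))) \<partial>lborel) < \<infinity>" .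
qed

lemma newtonian_energy_eq_interaction:
  fixes f :: "'a::euclidean_space \<Rightarrow> real"
  assumes "3 \<le> DIM('a)" and f: "bounded_with_bounded_support f"
  shows "newtonian_energy f = interaction f f"
proof -
  have [measurable]: "f \<in> borel_measurable borel" using f by measurable
  have "newtonian_energy f = (LINT y|lebesgue. (LINT x|lborel. f x * f y * newtonian_potential (x - y)))"
    unfolding newtonian_energy_def by (intro Bochner_Integration.integral_cong refl integral_completion) measurable
  also have "\<dots> = (LINT y|lborel. (LINT x|lborel. f x * f y * newtonian_potential (x - y)))"
    by (rule integral_completion) measurable
  also have "\<dots> = interaction f f"
    using lborel_pair.integral_snd[of "\<lambda>x y. f x * f y * newtonian_potential (x - y)"]
      interaction_integrable[OF assms(1) f f]
    by (simp add: interaction_def lborel_prod case_prod_unfold)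
  finally show ?thesis .
qed

lemma interaction_commute:
  fixes f g :: "'a::euclidean_space \<Rightarrow> real"
  assumes [measurable]: "f \<in> borel_measurable borel" "g \<in> borel_measurable borel"
  shows "interaction f g = interaction g f"
proof -
  have "(\<lambda>p. g (fst p) * f (snd p) * newtonian_potential (fst p - snd p))
      \<in> borel_measurable (lborel \<Otimes>\<^sub>M lborel)" by measurable
  from lborel_pair.integral_product_swap[OF this] show ?thesis
    using newtonian_potential_minus[of "_ - _ :: 'a"]
    by (simp add: interaction_def lborel_prod case_prod_unfold mult_ac)
qed

lemma interaction_add_left:
  fixes f g h :: "'a::euclidean_space \<Rightarrow> real"
  assumes "3 \<le> DIM('a)" "bounded_with_bounded_support f" "bounded_with_bounded_support g"
    "bounded_with_bounded_support h"
  shows "interaction (\<lambda>x. f x + g x) h = interaction f h + interaction g h"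
  using Bochner_Integration.integral_add[OF interaction_integrable[OF assms(1,2,4)]
      interaction_integrable[OF assms(1,3,4)]]
  by (simp add: interaction_def algebra_simps)

lemma interaction_cmult_left: "interaction (\<lambda>x. c * f x) g = c * interaction f g"
  by (simp add: interaction_def mult.assoc)

lemma newtonian_energy_add_cmult:
  fixes f g :: "'a::euclidean_space \<Rightarrow> real"
  assumes dim: "3 \<le> DIM('a)" and f: "bounded_with_bounded_support f" and g: "bounded_with_bounded_support g"
  shows "newtonian_energy (\<lambda>x. f x + c * g x)
    = newtonian_energy f + 2 * c * interaction f g + c\<^sup>2 * newtonian_energy g"
proof -
  note cg = bounded_with_bounded_support_cmult[OF g, of c]
  note s = bounded_with_bounded_support_add[OF f cg]
  note [measurable] = f[THEN bounded_with_bounded_supportD] g[THEN bounded_with_bounded_supportD]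
  have com: "interaction g f = interaction f g" by (intro interaction_commute) measurable
  have "interaction u (\<lambda>x. f x + c * g x) = interaction f u + c * interaction g u"
    if u: "bounded_with_bounded_support u" for u
  proof -
    note [measurable] = u[THEN bounded_with_bounded_supportD]
    have "interaction u (\<lambda>x. f x + c * g x) = interaction (\<lambda>x. f x + c * g x) u"
      by (intro interaction_commute) measurable
    then show ?thesis
      by (simp add: interaction_add_left[OF dim f cg u] interaction_cmult_left)
  qed
  then show ?thesis
    using newtonian_energy_eq_interaction[OF dim] f g s interaction_add_left[OF dim f cg s]
    by (simp add: interaction_cmult_left com power2_eq_square algebra_simps)
qed

section \<open>Positivity of the energy\<close>

text \<open>The formula for the potential as an average over balls holds only off the diagonal; this
  is what allows its use under the double integral.\<close>

lemma AE_fst_neq_snd: "AE p in lborel. fst p \<noteq> (snd p :: 'a::euclidean_space)"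
proof -
  have "open {p :: 'a \<times> 'a. fst p \<noteq> snd p}"
    by (intro open_Collect_neq continuous_intros)
  then have "{p \<in> space (lborel \<Otimes>\<^sub>M lborel). fst p \<noteq> (snd p :: 'a)} \<in> sets (lborel \<Otimes>\<^sub>M lborel)"
    unfolding lborel_prod by simp
  moreover have "AE x in lborel. AE y in lborel. fst (x, y) \<noteq> (snd (x, y) :: 'a)"
  proof (rule AE_I2)
    show "AE y in lborel. fst (x, y) \<noteq> snd (x, y)" for x :: 'a
      using AE_lborel_singleton[of x] by eventually_elim auto
  qed
  ultimately have "AE p in lborel \<Otimes>\<^sub>M lborel. fst p \<noteq> (snd p :: 'a)"
    by (rule lborel_pair.AE_pair_measure)
  then show ?thesis unfolding lborel_prod .
qed

lemma integral_fst_times_snd: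
  fixes f g :: "'a::euclidean_space \<Rightarrow> real"
  assumes "integrable lborel f" "integrable lborel g"
  shows "(\<integral>p. f (fst p) * g (snd p) \<partial>lborel) = integral\<^sup>L lborel f * integral\<^sup>L lborel g"
proof -
  have [measurable]: "f \<in> borel_measurable borel" "g \<in> borel_measurable borel"
    using assms by (auto dest: borel_measurable_integrable)
  have "integrable (lborel \<Otimes>\<^sub>M lborel) (\<lambda>p. f (fst p) * g (snd p))"
  proof (rule lborel_pair.Fubini_integrable)
    show "integrable lborel (\<lambda>x. \<integral>y. norm (f (fst (x, y)) * g (snd (x, y))) \<partial>lborel)"
      using assms by (simp add: abs_mult)
  qed (use assms in auto)
  from lborel_pair.integral_fst'[OF this] show ?thesis
    by (simp add: lborel_prod)
qed

text \<open>For a fixed ball the kernel is a product of a function of x and a function of y, so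
  integrating over both points first gives the square of the mass of f in the ball. Integrability
  over all balls is part of the conclusion, because later comparisons of Bochner integrals rely on
  it.\<close>

lemma newtonian_energy_ball_averages:
  assumes dim: "3 \<le> DIM('a::euclidean_space)"
  obtains c where "c > 0"
    "\<And>f :: 'a \<Rightarrow> real. bounded_with_bounded_support f \<Longrightarrow>
      integrable lborel (\<lambda>q. (\<integral>x. f x * in_ball x q \<partial>lborel)\<^sup>2 / snd q ^ (2 * DIM('a) - 1)) \<and>
      newtonian_energy f = c * (\<integral>q. (\<integral>x. f x * in_ball x q \<partial>lborel)\<^sup>2 / snd q ^ (2 * DIM('a) - 1) \<partial>lborel)"
proof -
  obtain c where c: "c > 0" "\<And>x y :: 'a. x \<noteq> y \<Longrightarrow>
      ennreal (newtonian_potential (x - y)) = ennreal c * ball_potential x y"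
    using newtonian_potential_eq_ball_potential[OF dim] by blast
  show ?thesis
  proof (rule that[OF c(1)])
    fix f :: "'a \<Rightarrow> real" assume f: "bounded_with_bounded_support f"
    have [measurable]: "f \<in> borel_measurable borel" using f by measurable
    define h where "h p q = f (fst p) * f (snd p) * ball_kernel (fst p) (snd p) q" for p q
    \<comment> \<open>\<open>X\<close> is the same integral with absolute values inside. It is
      finite by absolute convergence of the energy, which justifies the exchange of the integrals
      for sign-changing f.\<close>
    define X where "X = (\<integral>\<^sup>+p. ennreal \<bar>f (fst p) * f (snd p)\<bar> * ball_potential (fst p) (snd p) \<partial>lborel)"
    have "ennreal c * X = (\<integral>\<^sup>+p. ennreal c * (ennreal \<bar>f (fst p) * f (snd p)\<bar> * ball_potential (fst p) (snd p)) \<partial>lborel)"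
      unfolding X_def by (rule nn_integral_cmult[symmetric]) measurable
    also have "\<dots> = (\<integral>\<^sup>+p. ennreal (norm (f (fst p) * f (snd p) * newtonian_potential (fst p - snd p))) \<partial>lborel)"
    proof (rule nn_integral_cong_AE, use AE_fst_neq_snd in eventually_elim)
      case (elim p)
      have "ennreal (norm (f (fst p) * f (snd p) * newtonian_potential (fst p - snd p)))
          = ennreal \<bar>f (fst p) * f (snd p)\<bar> * ennreal (newtonian_potential (fst p - snd p))"
        using newtonian_potential_nonneg[OF dim, of "fst p - snd p"]
        by (simp add: abs_mult flip: ennreal_mult)
      then show ?case using c(2)[OF elim] by (simp add: mult_ac)
    qed
    also have "\<dots> < \<infinity>"
      using interaction_integrable[OF dim f f] by (simp add: integrable_iff_bounded)
    finally have X: "X < \<infinity>"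
      using c(1) by (auto simp: ennreal_mult_less_top)
    have meas: "(\<lambda>(p, q). h p q) \<in> borel_measurable (lborel \<Otimes>\<^sub>M lborel)"
      unfolding h_def by measurable
    have int: "integrable (lborel \<Otimes>\<^sub>M lborel) (\<lambda>(p, q). h p q)"
    proof (rule integrableI_bounded[OF meas])
      have "(\<integral>\<^sup>+z. ennreal (norm (case z of (p, q) \<Rightarrow> h p q)) \<partial>(lborel \<Otimes>\<^sub>M lborel))
          = (\<integral>\<^sup>+p. \<integral>\<^sup>+q. ennreal (norm (h p q)) \<partial>lborel \<partial>lborel)"
        using meas by (subst lborel.nn_integral_fst[symmetric]) auto
      also have "\<dots> = X"
        unfolding X_def
      proof (rule nn_integral_cong)
        fix p :: "'a \<times> 'a"
        have "(\<integral>\<^sup>+q. ennreal (norm (h p q)) \<partial>lborel)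
          = (\<integral>\<^sup>+q. ennreal \<bar>f (fst p) * f (snd p)\<bar> * ennreal (ball_kernel (fst p) (snd p) q) \<partial>lborel)"
          by (simp add: h_def abs_mult ball_kernel_nonneg ennreal_mult)
        also have "\<dots> = ennreal \<bar>f (fst p) * f (snd p)\<bar> * ball_potential (fst p) (snd p)"
          unfolding ball_potential_def by (rule nn_integral_cmult) measurable
        finally show "(\<integral>\<^sup>+q. ennreal (norm (h p q)) \<partial>lborel) = \<dots>" .
      qed
      finally show "(\<integral>\<^sup>+z. ennreal (norm (case z of (p, q) \<Rightarrow> h p q)) \<partial>(lborel \<Otimes>\<^sub>M lborel)) < \<infinity>"
        using X by simp
    qed
    have sq: "(\<integral>p. h p q \<partial>lborel) = (\<integral>x. f x * in_ball x q \<partial>lborel)\<^sup>2 / snd q ^ (2 * DIM('a) - 1)" for q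
    proof -
      have "integrable lborel (\<lambda>x. f x * in_ball x q)"
        by (rule Bochner_Integration.integrable_bound[OF bounded_with_bounded_support_integrable[OF f]])
           (auto simp: in_ball_def)
      from integral_fst_times_snd[OF this this] show ?thesis
        by (simp add: h_def ball_kernel_def power2_eq_square mult_ac)
    qed
    have "newtonian_energy f = (\<integral>p. c * (\<integral>q. h p q \<partial>lborel) \<partial>lborel)"
      unfolding newtonian_energy_eq_interaction[OF dim f] interaction_def
    proof (rule integral_cong_AE)
      show "AE p in lborel. f (fst p) * f (snd p) * newtonian_potential (fst p - snd p) = c * (\<integral>q. h p q \<partial>lborel)"
        using AE_fst_neq_snd
      proof eventually_elim
        case (elim p)
        have "c * enn2real (ball_potential (fst p) (snd p)) = newtonian_potential (fst p - snd p)"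
          using arg_cong[OF c(2)[OF elim], of enn2real] c(1) newtonian_potential_nonneg[OF dim, of "fst p - snd p"]
          by (simp add: enn2real_mult)
        moreover have "(\<integral>q. ball_kernel (fst p) (snd p) q \<partial>lborel) = enn2real (ball_potential (fst p) (snd p))"
          unfolding ball_potential_def
          by (rule integral_eq_nn_integral) (auto simp: ball_kernel_nonneg)
        ultimately show ?case
          by (simp add: h_def mult_ac)
      qed
    qed (unfold h_def, measurable)
    also have "\<dots> = c * (\<integral>q. \<integral>p. h p q \<partial>lborel \<partial>lborel)"
      using lborel_pair.Fubini_integral[OF int] by simp
    finally show "integrable lborel (\<lambda>q. (\<integral>x. f x * in_ball x q \<partial>lborel)\<^sup>2 / snd q ^ (2 * DIM('a) - 1)) \<and>
      newtonian_energy f = c * (\<integral>q. (\<integral>x. f x * in_ball x q \<partial>lborel)\<^sup>2 / snd q ^ (2 * DIM('a) - 1) \<partial>lborel)"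
      using lborel_pair.integrable_snd[OF int] by (simp add: sq)
  qed
qed

text \<open>Only the balls with center in B(z,\<delta>) and radius r between \<delta>/2 and \<delta>
  are kept. They lie in B(z,2\<delta>), so f has mass at most -k V r^n there, and the square divided
  by r^(2n-1) is at least k^2 V^2 r. All other balls contribute nonnegative terms, whatever f is
  there.\<close>

lemma newtonian_energy_lower_bound:
  assumes dim: "3 \<le> DIM('a::euclidean_space)"
  obtains c where "c > 0"
    "\<And>(f :: 'a \<Rightarrow> real) z \<delta> k. \<lbrakk>bounded_with_bounded_support f; 0 \<le> k; 0 < \<delta>;
      \<And>x. x \<in> ball z (2 * \<delta>) \<Longrightarrow> f x \<le> - k\<rbrakk> \<Longrightarrow> c * (k\<^sup>2 * \<delta> ^ (DIM('a) + 2)) \<le> newtonian_energy f"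
proof -
  obtain c where c: "c > 0" "\<And>f :: 'a \<Rightarrow> real. bounded_with_bounded_support f \<Longrightarrow>
      integrable lborel (\<lambda>q. (\<integral>x. f x * in_ball x q \<partial>lborel)\<^sup>2 / snd q ^ (2 * DIM('a) - 1)) \<and>
      newtonian_energy f = c * (\<integral>q. (\<integral>x. f x * in_ball x q \<partial>lborel)\<^sup>2 / snd q ^ (2 * DIM('a) - 1) \<partial>lborel)"
    using newtonian_energy_ball_averages[OF dim] by blast
  define V where "V = unit_ball_vol DIM('a)"
  have V: "V > 0" by (simp add: V_def)
  show ?thesis
  \<comment> \<open>The integrand is at least V^2 k^2 \<delta>/2 on a set of balls of measure V
    \<delta>^n \<delta>/2; the product is V^3/4 times k^2 \<delta>^(n+2).\<close>
  proof (rule that[of "c * V ^ 3 / 4"])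
    fix f :: "'a \<Rightarrow> real" and z \<delta> k
    assume f: "bounded_with_bounded_support f" and k: "0 \<le> k" and \<delta>: "0 < \<delta>"
      and le: "\<And>x. x \<in> ball z (2 * \<delta>) \<Longrightarrow> f x \<le> - k"
    define F where "F q = (\<integral>x. f x * in_ball x q \<partial>lborel)" for q
    let ?\<Phi> = "\<lambda>q. (F q)\<^sup>2 / snd q ^ (2 * DIM('a) - 1)"
    let ?T = "ball z \<delta> \<times> {\<delta> / 2<..<\<delta>}"
    have bound: "V\<^sup>2 * k\<^sup>2 * \<delta> / 2 \<le> ?\<Phi> q" if q: "q \<in> ?T" for q
    proof -
      obtain w r where q': "q = (w, r)" and w: "dist z w < \<delta>" and r: "\<delta> / 2 < r" "r < \<delta>"
        using q by (auto simp: mem_ball)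
      have r0: "r > 0" using r \<delta> by simp
      have ind: "in_ball x q = indicat_real (ball w r) x" for x
        by (simp add: q' in_ball_def indicator_def dist_commute)
      have i: "integrable lborel (indicat_real (ball w r))"
        using emeasure_lborel_ball_finite[of w r] by (intro integrable_real_indicator) auto
      have "F q \<le> (\<integral>x. - k * indicat_real (ball w r) x \<partial>lborel)"
        unfolding F_def ind
      proof (rule integral_mono)
        show "integrable lborel (\<lambda>x. f x * indicat_real (ball w r) x)"
          by (rule Bochner_Integration.integrable_bound[OF bounded_with_bounded_support_integrable[OF f]])
             (use f in \<open>auto simp: indicator_def\<close>)
        show "f x * indicat_real (ball w r) x \<le> - k * indicat_real (ball w r) x" for x
        proof (cases "x \<in> ball w r")
          case True
          then have "x \<in> ball z (2 * \<delta>)"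
            using dist_triangle[of z x w] w r by (simp add: mem_ball)
          then show ?thesis using le[of x] True by simp
        qed simp
      qed (use i in simp)
      also have "\<dots> = - (k * (V * r ^ DIM('a)))"
        using r0 by (simp add: content_ball V_def)
      finally have "(k * (V * r ^ DIM('a)))\<^sup>2 \<le> (- F q)\<^sup>2"
        using k V r0 by (intro power_mono) auto
      then have "(k * (V * r ^ DIM('a)))\<^sup>2 / r ^ (2 * DIM('a) - 1) \<le> ?\<Phi> q"
        using r0 by (simp add: q' divide_right_mono)
      moreover have "(k * (V * r ^ DIM('a)))\<^sup>2 / r ^ (2 * DIM('a) - 1) = k\<^sup>2 * V\<^sup>2 * r"
      proof -
        have "(r ^ DIM('a))\<^sup>2 = r ^ (Suc (2 * DIM('a) - 1))"
          by (simp add: mult.commute flip: power_mult)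
        also have "\<dots> = r * r ^ (2 * DIM('a) - 1)" by (rule power_Suc)
        finally show ?thesis using r0 by (simp add: power_mult_distrib)
      qed
      moreover have "V\<^sup>2 * k\<^sup>2 * \<delta> / 2 \<le> k\<^sup>2 * V\<^sup>2 * r"
        using mult_left_mono[of "\<delta> / 2" r "k\<^sup>2 * V\<^sup>2"] r by (simp add: mult_ac)
      ultimately show ?thesis by linarith
    qed
    \<comment> \<open>For radii that are not positive the mass is 0, so the odd power in the
      denominator cannot produce a negative value.\<close>
    have nn: "0 \<le> ?\<Phi> q" for q
    proof (cases "snd q > 0")
      case False
      then have "in_ball x q = 0" for x
        by (simp add: in_ball_def) (smt (verit) zero_le_dist)
      then show ?thesis by (simp add: F_def)
    qed simp
    have mT: "emeasure lborel ?T = ennreal (V * \<delta> ^ DIM('a) * (\<delta> / 2))"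
      using \<delta> V by (simp add: lborel_prod[symmetric] lborel.emeasure_pair_measure_Times emeasure_ball V_def
          flip: ennreal_mult)
    have sT: "?T \<in> sets lborel"
      by (simp add: borel_Times)
    have iT: "integrable lborel (indicat_real ?T)"
      using mT sT by (intro integrable_real_indicator) auto
    have "(\<integral>q. (V\<^sup>2 * k\<^sup>2 * \<delta> / 2) * indicat_real ?T q \<partial>lborel) \<le> (\<integral>q. ?\<Phi> q \<partial>lborel)"
    proof (rule integral_mono)
      show "integrable lborel ?\<Phi>" using c(2)[OF f] by (simp add: F_def)
      show "(V\<^sup>2 * k\<^sup>2 * \<delta> / 2) * indicat_real ?T q \<le> ?\<Phi> q" for q
        using bound[of q] nn[of q] by (cases "q \<in> ?T") auto
    qed (use iT in simp)
    moreover have "(\<integral>q. (V\<^sup>2 * k\<^sup>2 * \<delta> / 2) * indicat_real ?T q \<partial>lborel)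
        = (V\<^sup>2 * k\<^sup>2 * \<delta> / 2) * (V * \<delta> ^ DIM('a) * (\<delta> / 2))"
      using mT sT V \<delta> by (simp add: measure_def)
    ultimately have "(V\<^sup>2 * k\<^sup>2 * \<delta> / 2) * (V * \<delta> ^ DIM('a) * (\<delta> / 2)) \<le> (\<integral>q. ?\<Phi> q \<partial>lborel)"
      by (simp only:)
    then have "c * ((V\<^sup>2 * k\<^sup>2 * \<delta> / 2) * (V * \<delta> ^ DIM('a) * (\<delta> / 2))) \<le> newtonian_energy f"
      using c(2)[OF f] c(1) by (simp add: F_def)
    then show "c * V ^ 3 / 4 * (k\<^sup>2 * \<delta> ^ (DIM('a) + 2)) \<le> newtonian_energy f"
      by (simp add: power2_eq_square power3_eq_cube mult_ac)
  qed (use c V in simp)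
qed

section \<open>Interactions of indicator functions\<close>

lemma integrable_indicator_bounded:
  assumes "bounded A" "A \<in> sets borel"
  shows "integrable lborel (indicat_real (A :: 'a::euclidean_space set))"
  using assms by (intro bounded_with_bounded_support_integrable bounded_with_bounded_support_indicator)

lemma integral_indicator_Times:
  fixes A B :: "'a::euclidean_space set"
  assumes "bounded A" "A \<in> sets borel" "bounded B" "B \<in> sets borel"
  shows "integrable lborel (\<lambda>p. indicat_real A (fst p) * indicat_real B (snd p))"
    "(\<integral>p. indicat_real A (fst p) * indicat_real B (snd p) \<partial>lborel) = measure lborel A * measure lborel B"
proof -
  have "integrable lborel (indicat_real (A \<times> B))"
    using assms by (intro integrable_indicator_bounded bounded_Times borel_Times)
  then show "integrable lborel (\<lambda>p. indicat_real A (fst p) * indicat_real B (snd p))"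
    by (simp add: indicator_times[abs_def])
  show "(\<integral>p. indicat_real A (fst p) * indicat_real B (snd p) \<partial>lborel) = measure lborel A * measure lborel B"
    using assms by (simp add: integral_fst_times_snd integrable_indicator_bounded)
qed

lemma interaction_indicator_ge:
  fixes A B :: "'a::euclidean_space set"
  assumes dim: "3 \<le> DIM('a)" and AB: "bounded A" "A \<in> sets borel" "bounded B" "B \<in> sets borel"
    and le: "\<And>x y. x \<in> A \<Longrightarrow> y \<in> B \<Longrightarrow> \<alpha> \<le> newtonian_potential (x - y)"
  shows "\<alpha> * (measure lborel A * measure lborel B) \<le> interaction (indicat_real A) (indicat_real B)"
proof -
  have "\<alpha> * (measure lborel A * measure lborel B)
      = (\<integral>p. \<alpha> * (indicat_real A (fst p) * indicat_real B (snd p)) \<partial>lborel)"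
    using integral_indicator_Times[OF AB] by simp
  also have "\<dots> \<le> interaction (indicat_real A) (indicat_real B)"
    unfolding interaction_def
  proof (rule integral_mono)
    show "integrable lborel (\<lambda>p. \<alpha> * (indicat_real A (fst p) * indicat_real B (snd p)))"
      using integral_indicator_Times[OF AB] by (intro integrable_mult_right)
    show "integrable lborel (\<lambda>p. indicat_real A (fst p) * indicat_real B (snd p) * newtonian_potential (fst p - snd p))"
      using AB by (intro interaction_integrable dim bounded_with_bounded_support_indicator)
  qed (use le in \<open>auto simp: indicator_def\<close>)
  finally show ?thesis .
qed

lemma interaction_indicator_le:
  fixes A B :: "'a::euclidean_space set"
  assumes dim: "3 \<le> DIM('a)" and AB: "bounded A" "A \<in> sets borel" "bounded B" "B \<in> sets borel"
    and le: "\<And>x y. x \<in> A \<Longrightarrow> y \<in> B \<Longrightarrow> newtonian_potential (x - y) \<le> \<beta>"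
  shows "interaction (indicat_real A) (indicat_real B) \<le> \<beta> * (measure lborel A * measure lborel B)"
proof -
  have "interaction (indicat_real A) (indicat_real B)
      \<le> (\<integral>p. \<beta> * (indicat_real A (fst p) * indicat_real B (snd p)) \<partial>lborel)"
    unfolding interaction_def
  proof (rule integral_mono)
    show "integrable lborel (\<lambda>p. \<beta> * (indicat_real A (fst p) * indicat_real B (snd p)))"
      using integral_indicator_Times[OF AB] by (intro integrable_mult_right)
    show "integrable lborel (\<lambda>p. indicat_real A (fst p) * indicat_real B (snd p) * newtonian_potential (fst p - snd p))"
      using AB by (intro interaction_integrable dim bounded_with_bounded_support_indicator)
  qed (use le in \<open>auto simp: indicator_def\<close>)
  also have "\<dots> = \<beta> * (measure lborel A * measure lborel B)"
    using integral_indicator_Times[OF AB] by simp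
  finally show ?thesis .
qed

text \<open>Here the potential is integrated over A first, so the bound is linear in the volume of B
  and holds even when A and B touch and the potential is unbounded on their product.\<close>

lemma interaction_indicator_le_measure:
  fixes A B :: "'a::euclidean_space set"
  assumes dim: "3 \<le> DIM('a)" and AB: "bounded A" "A \<in> sets borel" "bounded B" "B \<in> sets borel"
    and sub: "A \<subseteq> ball 0 r" "B \<subseteq> ball 0 s"
  shows "interaction (indicat_real A) (indicat_real B)
    \<le> enn2real (\<integral>\<^sup>+x. indicator (ball 0 (r + s)) x * ennreal (newtonian_potential (x::'a)) \<partial>lborel)
      * measure lborel B"
proof -
  define L where "L = (\<integral>\<^sup>+x. indicator (ball 0 (r + s)) x * ennreal (newtonian_potential (x::'a)) \<partial>lborel)"
  have L: "L = ennreal (enn2real L)"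
    using newtonian_potential_finite_integral[OF dim, of "r + s"] by (simp add: L_def less_top)
  note [measurable] = AB(2,4)
  have B: "emeasure lborel B = ennreal (measure lborel B)"
    using emeasure_bounded_finite[OF AB(3)] by (simp add: emeasure_eq_ennreal_measure less_top)
  have "ennreal (interaction (indicat_real A) (indicat_real B))
      = (\<integral>\<^sup>+p. ennreal (indicat_real A (fst p) * indicat_real B (snd p) * newtonian_potential (fst p - snd p)) \<partial>lborel)"
    unfolding interaction_def
  proof (rule nn_integral_eq_integral[symmetric])
    show "integrable lborel (\<lambda>p. indicat_real A (fst p) * indicat_real B (snd p) * newtonian_potential (fst p - snd p))"
      using AB by (intro interaction_integrable dim bounded_with_bounded_support_indicator)
  qed (simp add: newtonian_potential_nonneg[OF dim])
  also have "\<dots> = (\<integral>\<^sup>+y. \<integral>\<^sup>+x. ennreal (indicat_real A x * indicat_real B y * newtonian_potential (x - y)) \<partial>lborel \<partial>lborel)"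
  proof -
    have "(\<lambda>p. ennreal (indicat_real A (fst p) * indicat_real B (snd p) * newtonian_potential (fst p - snd p)))
        \<in> borel_measurable (lborel \<Otimes>\<^sub>M lborel)" by measurable
    from lborel_pair.nn_integral_snd[OF this] show ?thesis by (simp add: lborel_prod)
  qed
  also have "\<dots> \<le> (\<integral>\<^sup>+y. L * indicator B y \<partial>lborel)"
  proof (rule nn_integral_mono)
    fix y
    show "(\<integral>\<^sup>+x. ennreal (indicat_real A x * indicat_real B y * newtonian_potential (x - y)) \<partial>lborel)
        \<le> L * indicator B y"
    proof (cases "y \<in> B")
      case True
      have "(\<integral>\<^sup>+x. ennreal (indicat_real A x * indicat_real B y * newtonian_potential (x - y)) \<partial>lborel)
          \<le> (\<integral>\<^sup>+x. indicator (ball 0 r) x * ennreal (newtonian_potential (x - y)) \<partial>lborel)"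
        using sub True by (intro nn_integral_mono) (auto simp: indicator_def)
      also have "\<dots> \<le> L"
        unfolding L_def using True sub(2) by (intro nn_integral_newtonian_potential_ball_le) auto
      finally show ?thesis using True by simp
    qed simp
  qed
  also have "\<dots> = L * emeasure lborel B"
    by (rule nn_integral_cmult_indicator) measurable
  also have "\<dots> = ennreal (enn2real L * measure lborel B)"
    by (subst L, subst B) (simp add: ennreal_mult)
  finally show ?thesis
    unfolding L_def[symmetric] by (simp add: ennreal_le_iff)
qed

lemma interaction_translate:
  fixes f g :: "'a::euclidean_space \<Rightarrow> real"
  assumes [measurable]: "f \<in> borel_measurable borel" "g \<in> borel_measurable borel"
  shows "interaction (\<lambda>x. f (x + a)) (\<lambda>x. g (x + a)) = interaction f g"
proof -
  let ?F = "\<lambda>p. f (fst p) * g (snd p) * newtonian_potential (fst p - snd p)"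
  have "interaction f g = (\<integral>p. ?F p \<partial>distr lborel borel ((+) (a, a)))"
    by (simp add: interaction_def lborel_distr_plus)
  also have "\<dots> = (\<integral>p. ?F ((a, a) + p) \<partial>lborel)"
    by (rule integral_distr) measurable
  also have "\<dots> = interaction (\<lambda>x. f (x + a)) (\<lambda>x. g (x + a))"
    by (simp add: interaction_def add.commute)
  finally show ?thesis by simp
qed

text \<open>The vector x must not be 0, since the convention
  \<open>newtonian_potential 0 = 0\<close> breaks monotonicity at the origin.\<close>

lemma newtonian_potential_antimono:
  fixes x y :: "'a::euclidean_space"
  assumes "3 \<le> DIM('a)" "0 < norm x" "norm x \<le> norm y"
  shows "newtonian_potential y \<le> newtonian_potential x"
  unfolding newtonian_potential_def using assms
  by (intro mult_left_mono powr_mono2') (auto simp: unit_ball_volume_eq)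

lemma newtonian_potential_strict_antimono:
  fixes x y :: "'a::euclidean_space"
  assumes "3 \<le> DIM('a)" "0 < norm x" "norm x < norm y"
  shows "newtonian_potential y < newtonian_potential x"
  unfolding newtonian_potential_def using assms
  by (intro mult_strict_left_mono powr_less_mono2_neg) (auto simp: unit_ball_volume_eq)

section \<open>An annulus with a concentrated small ball\<close>

text \<open>The hole in the unit ball has the radius of the bump, so the hole and a bump placed
  outside the unit ball have equal volume. With \<open>p = 0\<close> the bump fills the
  hole.\<close>

definition bump_density :: "real \<Rightarrow> real \<Rightarrow> 'a::euclidean_space \<Rightarrow> 'a \<Rightarrow> real"
  where "bump_density K \<epsilon> p x = indicat_real (ball 0 1 - ball 0 \<epsilon>) x + K * indicat_real (ball p \<epsilon>) x"

lemma bump_density_bounded: "bounded_with_bounded_support (bump_density K \<epsilon> p)"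
  unfolding bump_density_def [abs_def]
  by (intro bounded_with_bounded_support_add bounded_with_bounded_support_cmult
      bounded_with_bounded_support_indicator) (auto simp: bounded_diff)

lemma measure_lebesgue_ball:
  "r \<ge> 0 \<Longrightarrow> measure lebesgue (ball (c::'a::euclidean_space) r) = unit_ball_vol DIM('a) * r ^ DIM('a)"
  by (simp add: measure_completion content_ball)

lemma symmetrized_set_eq_ball:
  fixes D :: "'a::euclidean_space set"
  assumes "measure lebesgue D = unit_ball_vol DIM('a) * r ^ DIM('a)" "r \<ge> 0"
  shows "symmetrized_set D = ball 0 r"
proof -
  have "(THE s. 0 \<le> s \<and> measure lebesgue (ball (0::'a) s) = measure lebesgue D) = r"
  proof (rule the_equality)
    fix s assume s: "0 \<le> s \<and> measure lebesgue (ball (0::'a) s) = measure lebesgue D"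
    then have "unit_ball_vol DIM('a) * s ^ DIM('a) = unit_ball_vol DIM('a) * r ^ DIM('a)"
      using assms(1) measure_lebesgue_ball[of s "0::'a"] by presburger
    then have "s ^ DIM('a) = r ^ DIM('a)"
      using unit_ball_vol_pos[of "DIM('a)"] by (metis mult_left_cancel of_nat_0_le_iff order_less_irrefl)
    then show "s = r" using s assms(2) by (meson DIM_positive power_eq_imp_eq_base)
  qed (use assms measure_lebesgue_ball[of r "0::'a"] in auto)
  then show ?thesis by (simp add: symmetrized_set_def)
qed

lemma measure_annulus:
  fixes \<epsilon> :: real
  assumes "0 \<le> \<epsilon>" "\<epsilon> \<le> 1"
  shows "measure lborel (ball 0 1 - ball (0::'a::euclidean_space) \<epsilon>) = unit_ball_vol DIM('a) * (1 - \<epsilon> ^ DIM('a))"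
proof -
  have "measure lborel (ball 0 1 - ball (0::'a) \<epsilon>) = measure lborel (ball (0::'a) 1) - measure lborel (ball (0::'a) \<epsilon>)"
    using assms emeasure_lborel_ball_finite[of "0::'a" 1] by (intro measure_Diff) auto
  then show ?thesis using assms by (simp add: content_ball algebra_simps)
qed

text \<open>The bound on \<open>norm p\<close> keeps the bump disjoint from the unit ball. At
  heights in (0,1) the superlevel set is annulus and bump together, with the volume of the unit
  ball; from 1 up to K it is the bump alone; from K on it is empty.\<close>

lemma decreasing_rearrangement_bump_density:
  fixes p :: "'a::euclidean_space"
  assumes \<epsilon>: "0 < \<epsilon>" "\<epsilon> < 1" and K: "1 < K" and p: "1 + \<epsilon> \<le> norm p"
  shows "decreasing_rearrangement (bump_density K \<epsilon> p) = bump_density K \<epsilon> 0"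
proof
  fix x :: 'a
  let ?D = "\<lambda>h. {y. bump_density K \<epsilon> p y > h}"
  have disj: "y \<notin> ball p \<epsilon>" if "y \<in> ball 0 1" for y
    using that p norm_triangle_ineq2[of p y] by (simp add: dist_norm)
  have low: "symmetrized_set (?D h) = ball 0 1" if "0 < h" "h < 1" for h
  proof -
    have "?D h = (ball 0 1 - ball 0 \<epsilon>) \<union> ball p \<epsilon>"
      using that K disj by (auto simp: bump_density_def indicator_def split: split_of_bool_asm)
    moreover have "measure lborel ((ball 0 1 - ball 0 \<epsilon>) \<union> ball p \<epsilon>) = unit_ball_vol DIM('a) * 1 ^ DIM('a)"
    proof -
      have "measure lborel ((ball 0 1 - ball 0 \<epsilon>) \<union> ball p \<epsilon>)
          = measure lborel (ball 0 1 - ball (0::'a) \<epsilon>) + measure lborel (ball p \<epsilon>)"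
        using disj emeasure_lborel_ball_finite[of p \<epsilon>]
          emeasure_bounded_finite[of "ball 0 1 - ball (0::'a) \<epsilon>"]
        by (intro measure_Union) (auto simp: bounded_diff less_top)
      then show ?thesis using \<epsilon> by (simp add: measure_annulus content_ball algebra_simps)
    qed
    ultimately show ?thesis
      by (intro symmetrized_set_eq_ball) (simp_all add: measure_completion)
  qed
  have mid: "symmetrized_set (?D h) = ball 0 \<epsilon>" if "1 \<le> h" "h < K" for h
  proof -
    have "?D h = ball p \<epsilon>"
      using that K disj by (auto simp: bump_density_def indicator_def split: split_of_bool_asm split_of_bool)
    then show ?thesis
      using \<epsilon> by (intro symmetrized_set_eq_ball) (simp_all add: content_ball)
  qed
  have high: "symmetrized_set (?D h) = {}" if "K \<le> h" for h
  proof -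
    have "?D h = {}"
      using that K disj by (auto simp: bump_density_def indicator_def split: split_of_bool_asm)
    then have "symmetrized_set (?D h) = ball 0 0"
      by (intro symmetrized_set_eq_ball) simp_all
    then show ?thesis by simp
  qed
  \<comment> \<open>\<open>T\<close> is the length of the interval of positive heights whose
    symmetrized superlevel set contains x.\<close>
  define T :: real where "T = (if x \<in> ball 0 \<epsilon> then K else if x \<in> ball 0 1 then 1 else 0)"
  have "indicat_real {0<..} h *\<^sub>R indicat_real (symmetrized_set (?D h)) x = indicat_real {0<..<T} h" for h
  proof -
    consider "h \<le> 0" | "0 < h" "h < 1" | "1 \<le> h" "h < K" | "K \<le> h" by linarith
    then show ?thesis
      using \<epsilon> K by cases (auto simp: low mid high T_def)
  qed
  then have "decreasing_rearrangement (bump_density K \<epsilon> p) x = (LINT h|lebesgue. indicat_real {0<..<T} h)"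
    by (simp add: decreasing_rearrangement_def set_lebesgue_integral_def)
  also have "\<dots> = T"
    using K by (simp add: T_def)
  also have "\<dots> = bump_density K \<epsilon> 0 x"
    using \<epsilon> by (auto simp: bump_density_def T_def)
  finally show "decreasing_rearrangement (bump_density K \<epsilon> p) x = bump_density K \<epsilon> 0 x" .
qed

lemma bump_density_L1:
  fixes p :: "'a::euclidean_space"
  assumes "0 \<le> \<epsilon>" "\<epsilon> \<le> 1" "0 \<le> K"
  shows "bump_density K \<epsilon> p \<in> L1_nonneg"
    "L1_norm (bump_density K \<epsilon> p) = unit_ball_vol DIM('a) * (1 - \<epsilon> ^ DIM('a) + K * \<epsilon> ^ DIM('a))"
proof -
  have nn: "0 \<le> bump_density K \<epsilon> p x" for x
    using assms by (simp add: bump_density_def)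
  note b = bump_density_bounded[of K \<epsilon> p]
  then show "bump_density K \<epsilon> p \<in> L1_nonneg"
    using nn bounded_with_bounded_support_integrable[OF b] bounded_with_bounded_supportD[OF b]
    by (simp add: L1_nonneg_def integrable_completion)
  have "L1_norm (bump_density K \<epsilon> p) = (LINT x|lborel. bump_density K \<epsilon> p x)"
    using nn bounded_with_bounded_supportD[OF b] by (simp add: L1_norm_def integral_completion)
  also have "\<dots> = measure lborel (ball 0 1 - ball (0::'a) \<epsilon>) + K * measure lborel (ball p \<epsilon>)"
    unfolding bump_density_def
    by (subst Bochner_Integration.integral_add)
       (auto simp: bounded_diff intro!: integrable_mult_right integrable_indicator_bounded)
  also have "\<dots> = unit_ball_vol DIM('a) * (1 - \<epsilon> ^ DIM('a) + K * \<epsilon> ^ DIM('a))"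
    using assms by (simp add: measure_annulus content_ball algebra_simps)
  finally show "L1_norm (bump_density K \<epsilon> p) = \<dots>" .
qed

text \<open>The value K bounds the density everywhere, by disjointness, and is attained on an open
  ball, so no smaller bound holds almost everywhere.\<close>

lemma bump_density_Linfty:
  fixes p :: "'a::euclidean_space"
  assumes \<epsilon>: "0 < \<epsilon>" and K: "1 < K" and p: "1 + \<epsilon> \<le> norm p"
  shows "Linfty_norm (bump_density K \<epsilon> p) = ereal K" "bump_density K \<epsilon> p \<in> Linfty"
proof -
  let ?\<rho> = "bump_density K \<epsilon> p"
  have disj: "y \<notin> ball p \<epsilon>" if "y \<in> ball 0 1" for y
    using that p norm_triangle_ineq2[of p y] by (simp add: dist_norm)
  have b [measurable]: "?\<rho> \<in> borel_measurable borel"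
    by (rule bounded_with_bounded_supportD[OF bump_density_bounded])
  have m: "?\<rho> \<in> borel_measurable lebesgue"
    using b by (simp add: measurable_completion)
  then have me: "(\<lambda>x. ereal \<bar>?\<rho> x\<bar>) \<in> borel_measurable lebesgue"
    by measurable
  have le: "\<bar>?\<rho> x\<bar> \<le> K" for x
    using K disj[of x] by (auto simp: bump_density_def indicator_def split: split_of_bool)
  show *: "Linfty_norm ?\<rho> = ereal K"
    unfolding Linfty_norm_def esssup_eq_AE[OF me]
  proof (rule antisym)
    show "Inf {z. AE x in lebesgue. ereal \<bar>?\<rho> x\<bar> \<le> z} \<le> ereal K"
      using le by (intro Inf_lower) auto
    show "ereal K \<le> Inf {z. AE x in lebesgue. ereal \<bar>?\<rho> x\<bar> \<le> z}"
    proof (rule Inf_greatest, clarify, rule ccontr)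
      fix z assume z: "AE x in lebesgue. ereal \<bar>?\<rho> x\<bar> \<le> z" and "\<not> ereal K \<le> z"
      have "x \<notin> ball p \<epsilon>" if "ereal \<bar>?\<rho> x\<bar> \<le> z" for x
      proof
        assume x: "x \<in> ball p \<epsilon>"
        then have "x \<notin> ball 0 1" using disj by blast
        then have "?\<rho> x = K" using x by (simp add: bump_density_def)
        then show False using that \<open>\<not> ereal K \<le> z\<close> K by simp
      qed
      then have "AE x in lebesgue. x \<notin> ball p \<epsilon>"
        using z by (auto elim: eventually_mono)
      then have "AE x in lborel. x \<notin> ball p \<epsilon>"
        by (simp add: AE_completion_iff)
      then show False
        using not_AE_notin_open[of "ball p \<epsilon>"] \<epsilon> by auto
    qed
  qed
  show "?\<rho> \<in> Linfty"
    using m * by (simp add: Linfty_def)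
qed

section \<open>Energy deficit and energy of the translated difference\<close>

text \<open>Moving the bump leaves both self-energies unchanged, by translation invariance; only the
  cross term between annulus and bump differs.\<close>

lemma bump_density_energy_diff:
  fixes p :: "'a::euclidean_space"
  assumes dim: "3 \<le> DIM('a)"
  shows "newtonian_energy (bump_density K \<epsilon> (0::'a)) - newtonian_energy (bump_density K \<epsilon> p)
    = 2 * K * (interaction (indicat_real (ball 0 1 - ball (0::'a) \<epsilon>)) (indicat_real (ball 0 \<epsilon>))
      - interaction (indicat_real (ball 0 1 - ball 0 \<epsilon>)) (indicat_real (ball p \<epsilon>)))"
proof -
  have b: "bounded_with_bounded_support (indicat_real (ball q \<epsilon>))" for q :: 'a
    by (intro bounded_with_bounded_support_indicator) auto
  have b': "bounded_with_bounded_support (indicat_real (ball 0 1 - ball (0::'a) \<epsilon>))"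
    by (intro bounded_with_bounded_support_indicator) (auto simp: bounded_diff)
  have eq: "indicat_real (ball p \<epsilon>) = (\<lambda>x. indicat_real (ball 0 \<epsilon>) (x + - p))"
    by (auto simp: fun_eq_iff indicator_def dist_norm norm_minus_commute)
  have "interaction (indicat_real (ball p \<epsilon>)) (indicat_real (ball p \<epsilon>))
      = interaction (indicat_real (ball (0::'a) \<epsilon>)) (indicat_real (ball 0 \<epsilon>))"
    unfolding eq by (rule interaction_translate) (rule bounded_with_bounded_supportD[OF b])+
  then have self: "newtonian_energy (indicat_real (ball p \<epsilon>)) = newtonian_energy (indicat_real (ball (0::'a) \<epsilon>))"
    by (simp add: newtonian_energy_eq_interaction[OF dim b])
  have "newtonian_energy (bump_density K \<epsilon> q)
      = newtonian_energy (indicat_real (ball 0 1 - ball (0::'a) \<epsilon>))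
        + 2 * K * interaction (indicat_real (ball 0 1 - ball 0 \<epsilon>)) (indicat_real (ball q \<epsilon>))
        + K\<^sup>2 * newtonian_energy (indicat_real (ball q \<epsilon>))" for q :: 'a
    unfolding bump_density_def[abs_def] by (rule newtonian_energy_add_cmult[OF dim b' b])
  then show ?thesis
    by (simp add: self algebra_simps)
qed

text \<open>The interactions with the annulus are compared pointwise: the distances to points of the small
  ball are below 2 for \<open>B(0,\<epsilon>)\<close> and above 3 for \<open>B(p,\<epsilon>)\<close>.\<close>

lemma bump_density_energy_diff_bounds:
  fixes p :: "'a::euclidean_space"
  assumes dim: "3 \<le> DIM('a)" and \<epsilon>: "0 < \<epsilon>" "\<epsilon> < 1 / 16" and K: "0 < K" and p: "norm p = 5"
  shows "0 < newtonian_energy (bump_density K \<epsilon> (0::'a)) - newtonian_energy (bump_density K \<epsilon> p)"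
    "newtonian_energy (bump_density K \<epsilon> (0::'a)) - newtonian_energy (bump_density K \<epsilon> p)
      \<le> 2 * (enn2real (\<integral>\<^sup>+x. indicator (ball 0 2) x * ennreal (newtonian_potential (x::'a)) \<partial>lborel)
          * unit_ball_vol DIM('a)) * (K * \<epsilon> ^ DIM('a))"
proof -
  let ?A = "ball 0 1 - ball (0::'a) \<epsilon>"
  \<comment> \<open>The product of the volumes of annulus and bump, which is the same for both
    positions of the bump.\<close>
  define m where "m = measure lborel ?A * (unit_ball_vol DIM('a) * \<epsilon> ^ DIM('a))"
  have m: "0 < m"
    using \<epsilon> by (auto simp: m_def measure_annulus power_less_one_iff intro!: mult_pos_pos)
  have A: "bounded ?A" "?A \<in> sets borel" by (auto simp: bounded_diff)
  have B: "bounded (ball q \<epsilon>)" "ball q \<epsilon> \<in> sets borel" for q :: 'a by auto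
  obtain e :: 'a where e: "norm e = 1"
    using vector_choose_size[of 1] by auto
  have near: "newtonian_potential (2 *\<^sub>R e) * m \<le> interaction (indicat_real ?A) (indicat_real (ball 0 \<epsilon>))"
  proof -
    have pt: "newtonian_potential (2 *\<^sub>R e) \<le> newtonian_potential (x - y)" if "x \<in> ?A" "y \<in> ball 0 \<epsilon>" for x y
    proof (rule newtonian_potential_antimono[OF dim])
      show "0 < norm (x - y)" using that by auto
      show "norm (x - y) \<le> norm (2 *\<^sub>R e)"
        using that e \<epsilon> norm_triangle_ineq4[of x y] by auto
    qed
    have "newtonian_potential (2 *\<^sub>R e) * (measure lborel ?A * measure lborel (ball (0::'a) \<epsilon>))
        \<le> interaction (indicat_real ?A) (indicat_real (ball 0 \<epsilon>))"
      by (rule interaction_indicator_ge[OF dim A B]) (rule pt)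
    then show ?thesis
      using \<epsilon> by (simp add: m_def content_ball)
  qed
  have far: "interaction (indicat_real ?A) (indicat_real (ball p \<epsilon>)) \<le> newtonian_potential (3 *\<^sub>R e) * m"
  proof -
    have pt: "newtonian_potential (x - y) \<le> newtonian_potential (3 *\<^sub>R e)" if "x \<in> ?A" "y \<in> ball p \<epsilon>" for x y
    proof (rule newtonian_potential_antimono[OF dim])
      have "norm p \<le> norm (p - y) + norm (x - y) + norm x"
        using norm_triangle_ineq4[of "p - y" "x - y"] norm_triangle_ineq[of "p - x" x] by simp
      then show "norm (3 *\<^sub>R e) \<le> norm (x - y)"
        using that e \<epsilon> p by (auto simp: dist_norm)
    qed (use e in auto)
    have "interaction (indicat_real ?A) (indicat_real (ball p \<epsilon>))
        \<le> newtonian_potential (3 *\<^sub>R e) * (measure lborel ?A * measure lborel (ball p \<epsilon>))"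
      by (rule interaction_indicator_le[OF dim A B]) (rule pt)
    then show ?thesis
      using \<epsilon> by (simp add: m_def content_ball)
  qed
  have "newtonian_potential (3 *\<^sub>R e) * m < newtonian_potential (2 *\<^sub>R e) * m"
    using m e by (intro mult_strict_right_mono newtonian_potential_strict_antimono dim) auto
  then show "0 < newtonian_energy (bump_density K \<epsilon> (0::'a)) - newtonian_energy (bump_density K \<epsilon> p)"
    using near far K unfolding bump_density_energy_diff[OF dim] by (intro mult_pos_pos) auto
  define L where "L = (\<integral>\<^sup>+x. indicator (ball 0 2) x * ennreal (newtonian_potential (x::'a)) \<partial>lborel)"
  \<comment> \<open>The annulus touches the centered bump, so no pointwise upper bound is available.
    Both sets lie in the unit ball, whence the radius 2 = 1 + 1.\<close>
  have "interaction (indicat_real ?A) (indicat_real (ball 0 \<epsilon>))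
      \<le> enn2real L * measure lborel (ball (0::'a) \<epsilon>)"
    using interaction_indicator_le_measure[OF dim A B(1)[of 0] B(2)[of 0], of 1 1] \<epsilon>
      subset_ball[of \<epsilon> 1 "0::'a"] by (auto simp: L_def)
  moreover have "0 \<le> interaction (indicat_real ?A) (indicat_real (ball p \<epsilon>))"
    using interaction_indicator_ge[OF dim A B(1)[of p] B(2)[of p], of 0] newtonian_potential_nonneg[OF dim] by simp
  ultimately have "interaction (indicat_real ?A) (indicat_real (ball 0 \<epsilon>))
      - interaction (indicat_real ?A) (indicat_real (ball p \<epsilon>)) \<le> enn2real L * unit_ball_vol DIM('a) * \<epsilon> ^ DIM('a)"
    using \<epsilon> by (simp add: content_ball)
  then have "2 * K * (interaction (indicat_real ?A) (indicat_real (ball 0 \<epsilon>))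
      - interaction (indicat_real ?A) (indicat_real (ball p \<epsilon>)))
      \<le> 2 * K * (enn2real L * unit_ball_vol DIM('a) * \<epsilon> ^ DIM('a))"
    using K by (intro mult_left_mono) auto
  then show "newtonian_energy (bump_density K \<epsilon> (0::'a)) - newtonian_energy (bump_density K \<epsilon> p)
      \<le> 2 * (enn2real (\<integral>\<^sup>+x. indicator (ball 0 2) x * ennreal (newtonian_potential (x::'a)) \<partial>lborel)
          * unit_ball_vol DIM('a)) * (K * \<epsilon> ^ DIM('a))"
    unfolding bump_density_energy_diff[OF dim] L_def[symmetric] by (simp only: mult_ac)
qed

text \<open>If the translation misaligns the small balls, the difference is below \<open>- K / 2\<close> on the
  small ball at the origin; otherwise the unit balls are far apart and the difference is \<open>- 1\<close> on
  a fixed ball.\<close>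

lemma bump_density_translate_energy:
  assumes dim: "3 \<le> DIM('a::euclidean_space)"
  obtains c where "c > 0"
    "\<And>\<epsilon> K (p :: 'a) a. \<lbrakk>0 < \<epsilon>; \<epsilon> < 1 / 16; 2 \<le> K; norm p = 5; K\<^sup>2 * \<epsilon> ^ (DIM('a) + 2) = 1\<rbrakk> \<Longrightarrow>
      c \<le> newtonian_energy (\<lambda>x. bump_density K \<epsilon> p (x + a) - bump_density K \<epsilon> 0 x)"
proof -
  obtain c where c: "c > 0"
    "\<And>(f :: 'a \<Rightarrow> real) z \<delta> k. \<lbrakk>bounded_with_bounded_support f; 0 \<le> k; 0 < \<delta>;
      \<And>x. x \<in> ball z (2 * \<delta>) \<Longrightarrow> f x \<le> - k\<rbrakk> \<Longrightarrow> c * (k\<^sup>2 * \<delta> ^ (DIM('a) + 2)) \<le> newtonian_energy f"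
    using newtonian_energy_lower_bound[OF dim] by blast
  \<comment> \<open>The two entries are the values of k^2 \<delta>^(n+2) in the two cases: k = K/2,
    \<delta> = \<epsilon>/2 with the normalization of K, and k = 1, \<delta> = 1/8.\<close>
  define m :: real where "m = min (1 / 2 ^ (DIM('a) + 4)) (1 / 8 ^ (DIM('a) + 2))"
  show ?thesis
  proof (rule that[of "c * m"])
    show "c * m > 0" using c(1) by (simp add: m_def)
    fix \<epsilon> K :: real and p a :: 'a
    assume \<epsilon>: "0 < \<epsilon>" "\<epsilon> < 1 / 16" and K: "2 \<le> K" and p: "norm p = 5"
      and eq: "K\<^sup>2 * \<epsilon> ^ (DIM('a) + 2) = 1"
    let ?f = "\<lambda>x. bump_density K \<epsilon> p (x + a) - bump_density K \<epsilon> 0 x"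
    have f: "bounded_with_bounded_support ?f"
      by (intro bounded_with_bounded_support_diff bounded_with_bounded_support_translate bump_density_bounded)
    show "c * m \<le> newtonian_energy ?f"
    proof (cases "2 * \<epsilon> \<le> dist p a")
      case True
      \<comment> \<open>On B(0,\<epsilon>) the subtracted density is K. A point x + a in the bump
        would put a within 2\<epsilon> of p, so the translated density is at most 1 there, and 1 - K
        \<le> -K/2 since K \<ge> 2.\<close>
      have pt: "?f x \<le> - (K / 2)" if x: "x \<in> ball 0 (2 * (\<epsilon> / 2))" for x
      proof -
        have "x + a \<notin> ball p \<epsilon>"
          using x True norm_triangle_ineq[of "p - (x + a)" x] by (auto simp: dist_norm)
        then have "bump_density K \<epsilon> p (x + a) \<le> 1"
          by (simp add: bump_density_def)
        moreover have "bump_density K \<epsilon> 0 x = K"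
          using x by (simp add: bump_density_def)
        ultimately show ?thesis using K by simp
      qed
      have "c * ((K / 2)\<^sup>2 * (\<epsilon> / 2) ^ (DIM('a) + 2)) \<le> newtonian_energy ?f"
        using K \<epsilon> pt by (intro c(2)[OF f, where z = 0]) simp_all
      moreover have "(K / 2)\<^sup>2 * (\<epsilon> / 2) ^ (DIM('a) + 2) = (K\<^sup>2 * \<epsilon> ^ (DIM('a) + 2)) / 2 ^ (DIM('a) + 4)"
        by (simp add: power_divide power_add)
      ultimately have "c * (1 / 2 ^ (DIM('a) + 4)) \<le> newtonian_energy ?f"
        by (simp only: eq)
      moreover have "c * m \<le> c * (1 / 2 ^ (DIM('a) + 4))"
        using c(1) unfolding m_def by (intro mult_left_mono) auto
      ultimately show ?thesis by linarith
    next
      case False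
      obtain e :: 'a where e: "norm e = 1 / 2"
        using vector_choose_size[of "1 / 2"] by auto
      \<comment> \<open>The ball of radius 1/4 around a point of norm 1/2 stays in the annulus.
        Since a is close to p, x + a has norm above 3; it also misses the bump, because x has norm
        above 1/4 > 3\<epsilon>. This fixes the threshold 1/16.\<close>
      have pt: "?f x \<le> - 1" if x: "x \<in> ball e (2 * (1 / 8))" for x
      proof -
        have x1: "norm x < 3 / 4" "1 / 4 < norm x"
          using x e norm_triangle_ineq2[of x e] norm_triangle_ineq2[of e x]
          by (auto simp: dist_norm norm_minus_commute)
        have "norm a > 4"
          using False p \<epsilon> norm_triangle_ineq2[of p a] by (auto simp: dist_norm)
        then have "x + a \<notin> ball 0 1"
          using x1 norm_triangle_ineq4[of "x + a" x] by auto
        moreover have "x + a \<notin> ball p \<epsilon>"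
        proof
          assume "x + a \<in> ball p \<epsilon>"
          then have "norm x < 3 * \<epsilon>"
            using False norm_triangle_ineq4[of "p - a" "p - (x + a)"] by (auto simp: dist_norm)
          then show False using x1 \<epsilon> by simp
        qed
        ultimately have "bump_density K \<epsilon> p (x + a) = 0" by (simp add: bump_density_def)
        moreover have "bump_density K \<epsilon> 0 x = 1"
          using x1 \<epsilon> by (simp add: bump_density_def)
        ultimately show ?thesis by simp
      qed
      have "c * (1\<^sup>2 * (1 / 8) ^ (DIM('a) + 2)) \<le> newtonian_energy ?f"
        using pt by (intro c(2)[OF f, where z = e]) simp_all
      then have "c * (1 / 8 ^ (DIM('a) + 2)) \<le> newtonian_energy ?f"
        by (simp add: power_divide)
      moreover have "c * m \<le> c * (1 / 8 ^ (DIM('a) + 2))"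
        using c(1) unfolding m_def by (intro mult_left_mono) auto
      ultimately show ?thesis by linarith
    qed
  qed
qed

section \<open>Choice of the constants\<close>

theorem theorem1p4:
  assumes "CARD('n::finite) \<ge> 3"
  shows "\<exists>C::real. \<exists>\<epsilon>\<^sub>0::real. 0 < C \<and> 0 < \<epsilon>\<^sub>0 \<and> \<epsilon>\<^sub>0 < 1 \<and>
    (\<forall>\<epsilon>::real. 0 < \<epsilon> \<and> \<epsilon> < \<epsilon>\<^sub>0 \<longrightarrow>
      (\<exists>\<rho>::real ^ 'n \<Rightarrow> real.
        \<rho> \<in> L1_nonneg \<inter> Linfty \<and>
        closure {x. \<rho> x \<noteq> 0} \<subseteq> ball 0 7 \<and>
        unit_ball_volume TYPE(real ^ 'n) \<le> L1_norm \<rho> \<and>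
        L1_norm \<rho> \<le> 2 * unit_ball_volume TYPE(real ^ 'n) \<and>
        Linfty_norm \<rho> = ereal (\<epsilon> powr (- (real CARD('n) / 2 + 1))) \<and>
        0 < newtonian_energy (decreasing_rearrangement \<rho>) - newtonian_energy \<rho> \<and>
        newtonian_energy (decreasing_rearrangement \<rho>) - newtonian_energy \<rho>
          < C * \<epsilon> powr (real CARD('n) / 2 - 1) *
            (INF a. newtonian_energy (\<lambda>x. translate_fun a \<rho> x - decreasing_rearrangement \<rho> x))))"
proof -
  have dim: "3 \<le> DIM(real ^ 'n)" using assms by simp
  obtain c where c: "c > 0"
    "\<And>\<epsilon> K (p :: real ^ 'n) a. \<lbrakk>0 < \<epsilon>; \<epsilon> < 1 / 16; 2 \<le> K; norm p = 5; K\<^sup>2 * \<epsilon> ^ (DIM(real ^ 'n) + 2) = 1\<rbrakk> \<Longrightarrow>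
      c \<le> newtonian_energy (\<lambda>x. bump_density K \<epsilon> p (x + a) - bump_density K \<epsilon> 0 x)"
    using bump_density_translate_energy[OF dim] by blast
  obtain p :: "real ^ 'n" where p: "norm p = 5"
    using vector_choose_size[of 5] by auto
  define M where "M = 2 * (enn2real (\<integral>\<^sup>+x. indicator (ball 0 2) x *
      ennreal (newtonian_potential (x :: real ^ 'n)) \<partial>lborel) * unit_ball_vol DIM(real ^ 'n))"
  have M: "M \<ge> 0" by (simp add: M_def)
  show ?thesis
  \<comment> \<open>The deficit is at most M t with t = \<epsilon>^(n/2-1), and the infimum is at
    least c. The added 1 makes the final inequality strict.\<close>
  proof (rule exI[of _ "(M + 1) / c"], rule exI[of _ "1 / 16"], intro conjI allI impI)
    show "0 < (M + 1) / c" using M c(1) by simp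
    fix \<epsilon> :: real assume "0 < \<epsilon> \<and> \<epsilon> < 1 / 16"
    then have \<epsilon>: "0 < \<epsilon>" "\<epsilon> < 1 / 16" by auto
    define n where "n = CARD('n)"
    have n: "n \<ge> 3" "DIM(real ^ 'n) = n" using assms by (simp_all add: n_def)
    \<comment> \<open>\<open>K\<close> is the prescribed supremum norm, and \<open>t\<close> equals
      K \<epsilon>^n, the mass of the bump up to the factor \<omega>_n.\<close>
    define K where "K = \<epsilon> powr (- (real n / 2 + 1))"
    define t where "t = \<epsilon> powr (real n / 2 - 1)"
    have K: "2 \<le> K"
    proof -
      have "2 \<le> 1 / \<epsilon>" using \<epsilon> by (simp add: field_simps)
      also have "1 / \<epsilon> = \<epsilon> powr (- 1)" using \<epsilon> by (simp add: powr_minus_divide)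
      also have "\<dots> \<le> K" unfolding K_def using \<epsilon> by (intro powr_mono') auto
      finally show ?thesis .
    qed
    have t: "K * \<epsilon> ^ n = t"
      using \<epsilon> by (simp add: K_def t_def flip: powr_realpow powr_add)
    \<comment> \<open>This normalization makes the lower bound for the translates independent of
      \<epsilon>.\<close>
    have K2: "K\<^sup>2 * \<epsilon> ^ (n + 2) = 1"
    proof -
      have "K\<^sup>2 = \<epsilon> powr (- (real n / 2 + 1) + - (real n / 2 + 1))"
        by (simp only: K_def power2_eq_square powr_add)
      also have "- (real n / 2 + 1) + - (real n / 2 + 1) = - real (n + 2)" by simp
      also have "\<epsilon> powr (- real (n + 2)) = inverse (\<epsilon> ^ (n + 2))"
        using \<epsilon> by (simp only: powr_minus powr_realpow)
      finally have "K\<^sup>2 = inverse (\<epsilon> ^ (n + 2))" .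
      then show ?thesis using \<epsilon> by (simp only:) (rule left_inverse, simp)
    qed
    \<comment> \<open>These inequalities place the factor 1 - \<epsilon>^n + t of the L^1 norm
      between 1 and 2.\<close>
    have t1: "0 < t" "t \<le> 1" "\<epsilon> ^ n \<le> t"
    proof -
      show "0 < t" using \<epsilon> by (simp add: t_def)
      show "t \<le> 1" unfolding t_def using \<epsilon> n by (intro powr_le1) auto
      show "\<epsilon> ^ n \<le> t" using mult_right_mono[of 1 K "\<epsilon> ^ n"] K \<epsilon> by (simp flip: t)
    qed
    let ?\<rho> = "bump_density K \<epsilon> p"
    have re: "decreasing_rearrangement ?\<rho> = bump_density K \<epsilon> 0"
      using \<epsilon> K p by (intro decreasing_rearrangement_bump_density) auto
    have diff: "0 < newtonian_energy (bump_density K \<epsilon> (0 :: real ^ 'n)) - newtonian_energy ?\<rho>"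
        "newtonian_energy (bump_density K \<epsilon> (0 :: real ^ 'n)) - newtonian_energy ?\<rho> \<le> M * t"
      using bump_density_energy_diff_bounds[OF dim \<epsilon> _ p, of K] K n(2) by (simp_all add: M_def t)
    have "c \<le> (INF a. newtonian_energy (\<lambda>x. translate_fun a ?\<rho> x - bump_density K \<epsilon> 0 x))" (is "_ \<le> ?I")
      using c(2)[OF \<epsilon> K p] K2 n(2) by (intro cINF_greatest) (auto simp: translate_fun_def)
    then have "(M + 1) / c * t * c \<le> (M + 1) / c * t * ?I"
      using M c(1) t1(1) by (intro mult_left_mono) auto
    then have bound: "newtonian_energy (bump_density K \<epsilon> (0 :: real ^ 'n)) - newtonian_energy ?\<rho> < (M + 1) / c * t * ?I"
    proof -
      have "(M + 1) / c * t * c = M * t + t"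
        using c(1) by (simp add: field_simps)
      then show ?thesis
        using \<open>(M + 1) / c * t * c \<le> _\<close> diff(2) t1(1) by linarith
    qed
    have supp: "closure {x. ?\<rho> x \<noteq> 0} \<subseteq> ball 0 7"
    proof -
      \<comment> \<open>A closed ball absorbs the closure; the radius 6 suffices since 5 +
        \<epsilon> < 6.\<close>
      have "closure {x. ?\<rho> x \<noteq> 0} \<subseteq> cball 0 6"
      proof (rule closure_minimal)
        show "{x. ?\<rho> x \<noteq> 0} \<subseteq> cball 0 6"
        proof safe
          fix x assume "?\<rho> x \<noteq> 0"
          then have "x \<in> ball 0 1 \<or> x \<in> ball p \<epsilon>"
            by (auto simp: bump_density_def split: split_indicator_asm)
          then show "x \<in> cball 0 6"
            using p \<epsilon> norm_triangle_ineq2[of x p] by (auto simp: dist_norm norm_minus_commute)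
        qed
      qed simp
      then show ?thesis by (force simp: subset_iff)
    qed
    have norm: "L1_norm ?\<rho> = unit_ball_volume TYPE(real ^ 'n) * (1 - \<epsilon> ^ n + t)"
      using bump_density_L1(2)[of \<epsilon> K p] \<epsilon> K n(2) by (simp add: unit_ball_volume_eq t)
    have V: "0 < unit_ball_volume TYPE(real ^ 'n)" by (simp add: unit_ball_volume_eq)
    show "\<exists>\<rho>::real ^ 'n \<Rightarrow> real.
        \<rho> \<in> L1_nonneg \<inter> Linfty \<and>
        closure {x. \<rho> x \<noteq> 0} \<subseteq> ball 0 7 \<and>
        unit_ball_volume TYPE(real ^ 'n) \<le> L1_norm \<rho> \<and>
        L1_norm \<rho> \<le> 2 * unit_ball_volume TYPE(real ^ 'n) \<and>
        Linfty_norm \<rho> = ereal (\<epsilon> powr (- (real CARD('n) / 2 + 1))) \<and>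
        0 < newtonian_energy (decreasing_rearrangement \<rho>) - newtonian_energy \<rho> \<and>
        newtonian_energy (decreasing_rearrangement \<rho>) - newtonian_energy \<rho>
          < (M + 1) / c * \<epsilon> powr (real CARD('n) / 2 - 1) *
            (INF a. newtonian_energy (\<lambda>x. translate_fun a \<rho> x - decreasing_rearrangement \<rho> x))"
    proof (intro exI[of _ ?\<rho>] conjI)
      show "?\<rho> \<in> L1_nonneg \<inter> Linfty"
        using \<epsilon> K p bump_density_L1(1)[of \<epsilon> K p] bump_density_Linfty(2)[of \<epsilon> K p] by simp
      show "unit_ball_volume TYPE(real ^ 'n) \<le> L1_norm ?\<rho>"
        using mult_left_mono[of 1 "1 - \<epsilon> ^ n + t" "unit_ball_volume TYPE(real ^ 'n)"] t1 V by (simp add: norm)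
      show "L1_norm ?\<rho> \<le> 2 * unit_ball_volume TYPE(real ^ 'n)"
      proof -
        have "0 \<le> \<epsilon> ^ n" using \<epsilon> by simp
        then have "1 - \<epsilon> ^ n + t \<le> 2" using t1 by linarith
        then show ?thesis using V by (simp add: norm mult.commute)
      qed
      show "Linfty_norm ?\<rho> = ereal (\<epsilon> powr (- (real CARD('n) / 2 + 1)))"
        using \<epsilon> K p bump_density_Linfty(1)[of \<epsilon> K p] by (simp add: K_def n_def)
    qed (use supp diff(1) bound in \<open>simp_all only: re t_def n_def\<close>)
  qed simp_all
qed

end
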